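(* Let $F$ be a number field, $R$ an order in $F$, and let $1\to N\to\Gamma\xrightarrow{\lambda}G\to1$ be an extension of finite groups with $N$ abelian. Let $[\beta]\in H^2(\Gamma,R^* )$ be inflated from $G$, and let $\chi\in\mathrm{Lin}(N,F)$ be a $G$-invariant character. Let $\widetilde{\Psi}_{\chi,\beta}:\mathcal{U}(R^\beta[\Gamma])\to\mathcal{U}(R[\chi]^{\beta\cdot T_\alpha(\chi)}[G])$ be the group homomorphism induced by the ring epimorphism $\Psi_{\chi,\beta}:R^\beta[\Gamma]\to R[\chi]^{\beta\cdot T_\alpha(\chi)}[G]$, $r\,u_{n\mu(g)}\mapsto r\chi(n)v_g$ ($r\in R$, $n\in N$, $g\in G$). Then: (1) $\mathrm{coker}(\widetilde{\Psi}_{\chi,\beta})$ is finite, i.e. the image of $\widetilde{\Psi}_{\chi,\beta}$ has finite index. (2) If $N$ is central in $\Gamma$ and $\chi$ takes values in $R^*$, then the set of torsion units in $\ker(\widetilde{\Psi}_{\chi,\beta})$ equals $\{\chi(a)^{-1}u_a\mid a\in N\}$.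
   Context: $\mathcal{U}(S)$ is the unit group of a ring $S$; an order is a $\mathbb{Z}$-order. Cohomology groups with coefficients $R^*$ are for the trivial action and cocycles are normalized. For a commutative ring $S$ and $\gamma\in Z^2(H,S^* )$, $S^\gamma[H]$ is the twisted group ring: free $S$-module on $\{u_x\}_{x\in H}$ with $u_xu_y=\gamma(x,y)u_{xy}$ and $u_x$ commuting with $S$. "$[\beta]$ inflated from $G$" means $\beta(x,y)=\beta(\lambda(x),\lambda(y))$ for a $2$-cocycle of $G$ with values in $R^*$, again denoted $\beta$. The bases of $R^\beta[\Gamma]$ and $R[\chi]^{\beta\cdot T_\alpha(\chi)}[G]$ are denoted $\{u_x\}_{x\in\Gamma}$ and $\{v_g\}_{g\in G}$. Fix a section $\mu:G\to\Gamma$ of $\lambda$ with $\mu(1)=1$ and put $\alpha(g,h)=\mu(g)\mu(h)\mu(gh)^{-1}\in N$. $\mathrm{Lin}(N,F)$ is a set of linear characters $\chi:N\to K^*$ ($K\supseteq F$ a splitting field of $N$) containing the character of exactly one composition factor of $V\otimes_FK$ for each simple $FN$-module $V$ up to isomorphism. $\chi$ is $G$-invariant if $\chi(\mu(g)n\mu(g)^{-1})=\chi(n)$ for all $g\in G$, $n\in N$. $R[\chi]$ is the ring generated by $R$ and the values of $\chi$. $T_\alpha(\chi)(g,h)=\chi(\alpha(g,h))$ and $(\beta\cdot T_\alpha(\chi))(g,h)=\beta(g,h)\chi(\alpha(g,h))$. *)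

theory Defs
  imports
    "HOL-Algebra.Algebra"
    "HOL-Algebra.Algebraic_Closure_Type"
    "Jordan_Normal_Form.Matrix"
begin

text \<open>
  The large field \<open>K\<close> is the type \<open>'k\<close>; the number field, its order and the other coefficient
  rings are subsets of \<open>'k\<close>, regarded as substructures of the HOL-Algebra ring \<open>\<K>\<close>
  on the whole type.
\<close>

abbreviation type_field :: "'k::field ring" (\<open>\<K>\<close>)
  where "\<K> \<equiv> ring_of_type_algebra"

definition unit_set :: "'k::field set \<Rightarrow> 'k set"
  where "unit_set S = Units (\<K>\<lparr>carrier := S\<rparr>)"

section \<open>Number fields and orders\<close>

definition number_field :: "'k::field_char_0 set \<Rightarrow> bool"
  where "number_field F \<longleftrightarrow> subfield F \<K> \<and>
    (\<exists>B. finite B \<and> F = Modules.module.span (\<lambda>(q::rat) x. of_rat q * x) B)"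

definition order_in :: "'k::field_char_0 set \<Rightarrow> 'k set \<Rightarrow> bool"
  where "order_in R F \<longleftrightarrow> subring R \<K> \<and>
    (\<exists>B. finite B \<and> R = Modules.module.span (\<lambda>(m::int) x. of_int m * x) B) \<and>
    F = Modules.module.span (\<lambda>(q::rat) x. of_rat q * x) R"

section \<open>Twisted group rings\<close>

text \<open>Normalized 2-cocycles of \<open>H\<close> with values in the units of \<open>S\<close>, for the trivial action.\<close>

definition two_cocycle :: "('h, 'c) monoid_scheme \<Rightarrow> 'k::field set \<Rightarrow> ('h \<Rightarrow> 'h \<Rightarrow> 'k) \<Rightarrow> bool"
  where "two_cocycle H S \<gamma> \<longleftrightarrow>
    (\<forall>x\<in>carrier H. \<forall>y\<in>carrier H. \<gamma> x y \<in> unit_set S) \<and>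
    (\<forall>x\<in>carrier H. \<gamma> \<one>\<^bsub>H\<^esub> x = 1 \<and> \<gamma> x \<one>\<^bsub>H\<^esub> = 1) \<and>
    (\<forall>x\<in>carrier H. \<forall>y\<in>carrier H. \<forall>z\<in>carrier H.
       \<gamma> x y * \<gamma> (x \<otimes>\<^bsub>H\<^esub> y) z = \<gamma> y z * \<gamma> x (y \<otimes>\<^bsub>H\<^esub> z))"

text \<open>
  For a finite group \<open>H\<close>, the element \<open>\<Sum>x. f x u\<^sub>x\<close> is represented by its coefficient
  function \<open>f\<close>, extended by \<open>0\<close> outside \<open>H\<close>. The unit element \<open>u\<^sub>1\<close> is correct because
  cocycles are normalized.
\<close>

definition tg_elem :: "'k::field \<Rightarrow> 'h \<Rightarrow> 'h \<Rightarrow> 'k"  \<comment> \<open>\<open>r u\<^sub>x\<close>\<close>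
  where "tg_elem r x = (\<lambda>y. if y = x then r else 0)"

definition twisted_group_ring ::
    "('h, 'c) monoid_scheme \<Rightarrow> 'k::field set \<Rightarrow> ('h \<Rightarrow> 'h \<Rightarrow> 'k) \<Rightarrow> ('h \<Rightarrow> 'k) ring"
  where "twisted_group_ring H S \<gamma> =
    \<lparr> carrier = {f. (\<forall>x\<in>carrier H. f x \<in> S) \<and> (\<forall>x. x \<notin> carrier H \<longrightarrow> f x = 0)},
      monoid.mult = (\<lambda>f g x. \<Sum>(y, z) | y \<in> carrier H \<and> z \<in> carrier H \<and> y \<otimes>\<^bsub>H\<^esub> z = x.
                       f y * g z * \<gamma> y z),
      one = tg_elem 1 \<one>\<^bsub>H\<^esub>,
      ring.zero = (\<lambda>_. 0),
      add = (\<lambda>f g x. f x + g x) \<rparr>"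

definition torsion_units :: "('a, 'c) monoid_scheme \<Rightarrow> 'a set"
  where "torsion_units A = {u \<in> Units A. \<exists>k>0. u [^]\<^bsub>A\<^esub> (k::nat) = \<one>\<^bsub>A\<^esub>}"

section \<open>Representations and the set Lin\<close>

text \<open>
  Finitely generated \<open>E N\<close>-modules, for a subfield \<open>E\<close> of a type, are given by matrix
  representations with entries in \<open>E\<close>. With this encoding, the extension of scalars
  of a module to a larger field is the same family of matrices, read over the larger field.
\<close>

definition vecs :: "'k set \<Rightarrow> nat \<Rightarrow> 'k vec set"
  where "vecs E d = {v \<in> carrier_vec d. vec_set v \<subseteq> E}"

definition matrix_rep :: "('g, 'c) monoid_scheme \<Rightarrow> 'k::field set \<Rightarrow> nat \<Rightarrow> ('g \<Rightarrow> 'k mat) \<Rightarrow> bool"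
  where "matrix_rep N E d \<rho> \<longleftrightarrow>
    (\<forall>n\<in>carrier N. \<rho> n \<in> carrier_mat d d \<and> elements_mat (\<rho> n) \<subseteq> E) \<and>
    \<rho> \<one>\<^bsub>N\<^esub> = 1\<^sub>m d \<and>
    (\<forall>m\<in>carrier N. \<forall>n\<in>carrier N. \<rho> (m \<otimes>\<^bsub>N\<^esub> n) = \<rho> m * \<rho> n)"

definition invariant_subspace ::
    "('g, 'c) monoid_scheme \<Rightarrow> 'k::field set \<Rightarrow> nat \<Rightarrow> ('g \<Rightarrow> 'k mat) \<Rightarrow> 'k vec set \<Rightarrow> bool"
  where "invariant_subspace N E d \<rho> W \<longleftrightarrow>
    W \<subseteq> vecs E d \<and> 0\<^sub>v d \<in> W \<and>
    (\<forall>v\<in>W. \<forall>w\<in>W. v + w \<in> W) \<and> (\<forall>c\<in>E. \<forall>v\<in>W. c \<cdot>\<^sub>v v \<in> W) \<and>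
    (\<forall>n\<in>carrier N. \<forall>v\<in>W. \<rho> n *\<^sub>v v \<in> W)"

definition irreducible_rep ::
    "('g, 'c) monoid_scheme \<Rightarrow> 'k::field set \<Rightarrow> nat \<Rightarrow> ('g \<Rightarrow> 'k mat) \<Rightarrow> bool"
  where "irreducible_rep N E d \<rho> \<longleftrightarrow> matrix_rep N E d \<rho> \<and> d > 0 \<and>
    (\<forall>W. invariant_subspace N E d \<rho> W \<longrightarrow> W = {0\<^sub>v d} \<or> W = vecs E d)"

text \<open>
  \<open>'k\<close> is a splitting field of \<open>N\<close> if every irreducible representation over \<open>'k\<close> is
  absolutely irreducible, that is, stays irreducible over the algebraic closure.
\<close>

definition splitting_field :: "('g, 'c) monoid_scheme \<Rightarrow> 'k::field itself \<Rightarrow> bool"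
  where "splitting_field N T \<longleftrightarrow>
    (\<forall>d (\<rho> :: 'g \<Rightarrow> 'k mat). irreducible_rep N UNIV d \<rho> \<longrightarrow>
       irreducible_rep N UNIV d (\<lambda>n. map_mat to_ac (\<rho> n)))"

text \<open>
  \<open>\<sigma>\<close> is (up to isomorphism) a composition factor of \<open>\<rho>\<close> over \<open>'k\<close>: it is simple and isomorphic
  to a quotient \<open>W / ker \<phi>\<close> of a submodule \<open>W\<close>.
\<close>

definition composition_factor ::
    "('g, 'c) monoid_scheme \<Rightarrow> nat \<Rightarrow> ('g \<Rightarrow> 'k::field mat) \<Rightarrow> nat \<Rightarrow> ('g \<Rightarrow> 'k mat) \<Rightarrow> bool"
  where "composition_factor N d \<rho> m \<sigma> \<longleftrightarrow> irreducible_rep N UNIV m \<sigma> \<and>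
    (\<exists>W \<phi>. invariant_subspace N UNIV d \<rho> W \<and> \<phi> ` W = carrier_vec m \<and>
       (\<forall>v\<in>W. \<forall>w\<in>W. \<phi> (v + w) = \<phi> v + \<phi> w) \<and>
       (\<forall>c. \<forall>v\<in>W. \<phi> (c \<cdot>\<^sub>v v) = c \<cdot>\<^sub>v \<phi> v) \<and>
       (\<forall>n\<in>carrier N. \<forall>v\<in>W. \<phi> (\<rho> n *\<^sub>v v) = \<sigma> n *\<^sub>v \<phi> v))"

definition is_factor_character ::
    "('g, 'c) monoid_scheme \<Rightarrow> nat \<Rightarrow> ('g \<Rightarrow> 'k::field mat) \<Rightarrow> ('g \<Rightarrow> 'k) \<Rightarrow> bool"
  where "is_factor_character N d \<rho> \<chi> \<longleftrightarrow>
    (\<exists>m \<sigma>. composition_factor N d \<rho> m \<sigma> \<and> (\<forall>n\<in>carrier N. \<chi> n = (\<Sum>i<m. \<sigma> n $$ (i, i))))"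

text \<open>Extensionality makes a character determined by its values on \<open>N\<close>.\<close>

definition linear_characters :: "('g, 'c) monoid_scheme \<Rightarrow> ('g \<Rightarrow> 'k::field) set"
  where "linear_characters N = hom N (units_of \<K>) \<inter> extensional (carrier N)"

definition is_Lin :: "('g, 'c) monoid_scheme \<Rightarrow> 'k::field set \<Rightarrow> ('g \<Rightarrow> 'k) set \<Rightarrow> bool"
  where "is_Lin N F L \<longleftrightarrow> L \<subseteq> linear_characters N \<and>
    (\<forall>d \<rho>. irreducible_rep N F d \<rho> \<longrightarrow> (\<exists>!\<chi>. \<chi> \<in> L \<and> is_factor_character N d \<rho> \<chi>))"

section \<open>The map between the twisted group rings\<close>

definition adjoin_values :: "'k::field set \<Rightarrow> 'g set \<Rightarrow> ('g \<Rightarrow> 'k) \<Rightarrow> 'k set"  \<comment> \<open>\<open>R[\<chi>]\<close>\<close>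
  where "adjoin_values R N \<chi> = generate_ring \<K> (R \<union> \<chi> ` N)"

definition ext_cocycle ::
    "('g, 'c) monoid_scheme \<Rightarrow> ('h, 'd) monoid_scheme \<Rightarrow> ('h \<Rightarrow> 'g) \<Rightarrow> 'h \<Rightarrow> 'h \<Rightarrow> 'g"
  where "ext_cocycle \<Gamma> G \<mu> g h = \<mu> g \<otimes>\<^bsub>\<Gamma>\<^esub> \<mu> h \<otimes>\<^bsub>\<Gamma>\<^esub> inv\<^bsub>\<Gamma>\<^esub> (\<mu> (g \<otimes>\<^bsub>G\<^esub> h))"

text \<open>
  Every element of \<open>\<Gamma>\<close> is \<open>n \<mu>(g)\<close> for unique \<open>n \<in> N\<close> and \<open>g \<in> G\<close>, so this is the linear
  extension of \<open>r u\<^bsub>n \<mu>(g)\<^esub> \<mapsto> r \<chi>(n) v\<^sub>g\<close>; see \<open>Psi_tg_elem\<close>, \<open>Psi_ring_hom\<close> and \<open>Psi_surj\<close> below.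
\<close>

definition Psi ::
    "('g, 'c) monoid_scheme \<Rightarrow> ('h, 'd) monoid_scheme \<Rightarrow> 'g set \<Rightarrow> ('h \<Rightarrow> 'g) \<Rightarrow> ('g \<Rightarrow> 'k::field)
      \<Rightarrow> ('g \<Rightarrow> 'k) \<Rightarrow> 'h \<Rightarrow> 'k"
  where "Psi \<Gamma> G N \<mu> \<chi> f =
    (\<lambda>g. if g \<in> carrier G then \<Sum>n\<in>N. f (n \<otimes>\<^bsub>\<Gamma>\<^esub> \<mu> g) * \<chi> n else 0)"


section \<open>Well-definedness\<close>

text \<open>The defined objects are what they are called: rings, and a surjective ring homomorphism.\<close>

lemma type_field_simps [simp]:
  "carrier \<K> = UNIV" "x \<otimes>\<^bsub>\<K>\<^esub> y = x * y" "\<one>\<^bsub>\<K>\<^esub> = 1" "\<zero>\<^bsub>\<K>\<^esub> = 0" "x \<oplus>\<^bsub>\<K>\<^esub> y = x + y"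
  by (simp_all add: ring_of_type_algebra_def)

lemma type_field_ring: "ring (\<K> :: 'k::field ring)"
  by (rule ring_from_type_algebra)

lemma type_field_a_inv [simp]: "\<ominus>\<^bsub>\<K>\<^esub> x = - (x :: 'k::field)"
proof -
  interpret ring "\<K> :: 'k ring" by (rule type_field_ring)
  show ?thesis using minus_equality[of "- x" x] by simp
qed

lemma subringD:
  assumes "subring S (\<K> :: 'k::field ring)"
  shows "0 \<in> S" "1 \<in> S" "x \<in> S \<Longrightarrow> y \<in> S \<Longrightarrow> x + y \<in> S" "x \<in> S \<Longrightarrow> y \<in> S \<Longrightarrow> x * y \<in> S"
    "x \<in> S \<Longrightarrow> - x \<in> S"
  using subringE(2,3)[OF assms] subringE(7)[OF assms, of x y] subringE(6)[OF assms, of x y]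
    subringE(5)[OF assms, of x] by simp_all

lemma subring_sum:
  assumes "subring S (\<K> :: 'k::field ring)" "\<And>i. i \<in> I \<Longrightarrow> f i \<in> S"
  shows "sum f I \<in> S"
  using assms(2) by (induction I rule: infinite_finite_induct) (simp_all add: subringD(1,3)[OF assms(1)])

lemma unit_setD: "x \<in> unit_set S \<Longrightarrow> x \<in> S" "x \<in> unit_set S \<Longrightarrow> x \<noteq> 0"
  by (auto simp: unit_set_def Units_def)

lemma unit_setI: "x \<in> S \<Longrightarrow> y \<in> S \<Longrightarrow> x * y = 1 \<Longrightarrow> x \<in> unit_set S"
  by (auto simp: unit_set_def Units_def mult.commute)

lemma tg_sum_mult:
  fixes f g \<phi> :: "'h \<Rightarrow> 'k::field"
  assumes "group H" "finite (carrier H)"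
  shows "(\<Sum>x\<in>carrier H. (f \<otimes>\<^bsub>twisted_group_ring H S \<gamma>\<^esub> g) x * \<phi> x) =
    (\<Sum>y\<in>carrier H. \<Sum>z\<in>carrier H. f y * g z * \<gamma> y z * \<phi> (y \<otimes>\<^bsub>H\<^esub> z))"
proof -
  interpret group H by fact
  let ?C = "carrier H"
  let ?F = "\<lambda>(y, z). f y * g z * \<gamma> y z * \<phi> (y \<otimes>\<^bsub>H\<^esub> z)"
  have "(\<Sum>x\<in>?C. (f \<otimes>\<^bsub>twisted_group_ring H S \<gamma>\<^esub> g) x * \<phi> x) =
      (\<Sum>x\<in>?C. \<Sum>p | p \<in> ?C \<times> ?C \<and> (\<lambda>(y, z). y \<otimes>\<^bsub>H\<^esub> z) p = x. ?F p)"
  proof (rule sum.cong[OF refl])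
    fix x assume "x \<in> ?C"
    have *: "{(y, z). y \<in> ?C \<and> z \<in> ?C \<and> y \<otimes>\<^bsub>H\<^esub> z = x} =
        {p. p \<in> ?C \<times> ?C \<and> (\<lambda>(y, z). y \<otimes>\<^bsub>H\<^esub> z) p = x}" by auto
    show "(f \<otimes>\<^bsub>twisted_group_ring H S \<gamma>\<^esub> g) x * \<phi> x =
        (\<Sum>p | p \<in> ?C \<times> ?C \<and> (\<lambda>(y, z). y \<otimes>\<^bsub>H\<^esub> z) p = x. ?F p)"
      unfolding twisted_group_ring_def by (auto simp: * sum_distrib_right intro!: sum.cong)
  qed
  also have "\<dots> = sum ?F (?C \<times> ?C)"
    by (rule sum.group) (use assms(2) in auto)
  also have "\<dots> = (\<Sum>y\<in>?C. \<Sum>z\<in>?C. f y * g z * \<gamma> y z * \<phi> (y \<otimes>\<^bsub>H\<^esub> z))"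
    by (simp add: sum.cartesian_product)
  finally show ?thesis .
qed

lemma tg_eqI:
  fixes f g :: "'h \<Rightarrow> 'k::field"
  assumes "finite (carrier H)" "f \<in> carrier (twisted_group_ring H S \<gamma>)"
    "g \<in> carrier (twisted_group_ring H S \<gamma>)"
    "\<And>\<phi>. (\<Sum>x\<in>carrier H. f x * \<phi> x) = (\<Sum>x\<in>carrier H. g x * \<phi> x)"
  shows "f = g"
proof
  fix x
  show "f x = g x"
  proof (cases "x \<in> carrier H")
    case True
    have "(\<Sum>y\<in>carrier H. h y * (if y = x then 1 else 0)) = h x" for h :: "'h \<Rightarrow> 'k"
      using True assms(1) by (simp add: if_distrib sum.delta cong: if_cong)
    then show ?thesis using assms(4)[of "\<lambda>y. if y = x then 1 else 0"] by simp
  qed (use assms(2,3) in \<open>auto simp: twisted_group_ring_def\<close>)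
qed

lemma tg_elem_closed:
  assumes "subring S (\<K> :: 'k::field ring)" "r \<in> S" "x \<in> carrier H"
  shows "tg_elem r x \<in> carrier (twisted_group_ring H S \<gamma>)"
  using assms(2,3) subringD(1)[OF assms(1)] by (auto simp: twisted_group_ring_def tg_elem_def)

lemma tg_mult_closed:
  assumes "group H" "subring S (\<K> :: 'k::field ring)" "two_cocycle H S \<gamma>"
    "f \<in> carrier (twisted_group_ring H S \<gamma>)" "g \<in> carrier (twisted_group_ring H S \<gamma>)"
  shows "f \<otimes>\<^bsub>twisted_group_ring H S \<gamma>\<^esub> g \<in> carrier (twisted_group_ring H S \<gamma>)"
proof -
  interpret group H by fact
  have "(f \<otimes>\<^bsub>twisted_group_ring H S \<gamma>\<^esub> g) x \<in> S" for x
    using assms(3-) unfolding twisted_group_ring_def two_cocycle_def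
    by (auto intro!: subring_sum[OF assms(2)] subringD(4)[OF assms(2)] dest: unit_setD)
  moreover have "(f \<otimes>\<^bsub>twisted_group_ring H S \<gamma>\<^esub> g) x = 0" if "x \<notin> carrier H" for x
    using that unfolding twisted_group_ring_def by (auto intro!: sum.neutral)
  ultimately show ?thesis by (auto simp: twisted_group_ring_def)
qed

lemma twisted_group_ring_ring:
  assumes H: "group H" "finite (carrier H)"
    and S: "subring S (\<K> :: 'k::field ring)" and c: "two_cocycle H S \<gamma>"
  shows "ring (twisted_group_ring H S \<gamma>)" (is "ring ?A")
proof -
  interpret group H by fact
  note S' = subringD[OF S]
  have carr: "f \<in> carrier ?A \<longleftrightarrow> (\<forall>x\<in>carrier H. f x \<in> S) \<and> (\<forall>x. x \<notin> carrier H \<longrightarrow> f x = 0)" for f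
    by (simp add: twisted_group_ring_def)
  have add: "f \<oplus>\<^bsub>?A\<^esub> g = (\<lambda>x. f x + g x)" for f g by (simp add: twisted_group_ring_def)
  have one: "\<one>\<^bsub>?A\<^esub> = tg_elem 1 \<one>\<^bsub>H\<^esub>" and zero: "\<zero>\<^bsub>?A\<^esub> = (\<lambda>_. 0)" by (simp_all add: twisted_group_ring_def)
  have onec: "\<one>\<^bsub>?A\<^esub> \<in> carrier ?A" unfolding one by (rule tg_elem_closed[OF S]) (auto intro: S')
  note mc = tg_mult_closed[OF H(1) S c]
  note eqI = tg_eqI[OF H(2), where S = S and \<gamma> = \<gamma>]
  note sm = tg_sum_mult[OF H]
  have addc: "f \<oplus>\<^bsub>?A\<^esub> g \<in> carrier ?A" if "f \<in> carrier ?A" "g \<in> carrier ?A" for f g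
    using that by (auto simp: carr add intro: S')
  have norm: "\<gamma> \<one>\<^bsub>H\<^esub> x = 1" "\<gamma> x \<one>\<^bsub>H\<^esub> = 1" if "x \<in> carrier H" for x
    using c that by (auto simp: two_cocycle_def)
  show ?thesis
  proof (rule ringI)
    show "abelian_group ?A"
    proof (rule abelian_groupI)
      fix f assume f: "f \<in> carrier ?A"
      have "(\<lambda>x. - f x) \<in> carrier ?A" using f by (auto simp: carr intro: S')
      then show "\<exists>g\<in>carrier ?A. g \<oplus>\<^bsub>?A\<^esub> f = \<zero>\<^bsub>?A\<^esub>"
        by (rule bexI[rotated]) (simp add: add zero)
    qed (auto simp: carr add zero algebra_simps intro: S')
    show "monoid ?A"
    proof (rule monoidI)
      fix f assume f: "f \<in> carrier ?A"
      show "\<one>\<^bsub>?A\<^esub> \<otimes>\<^bsub>?A\<^esub> f = f"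
      proof (rule eqI)
        fix \<phi>
        have "(\<Sum>x\<in>carrier H. (\<one>\<^bsub>?A\<^esub> \<otimes>\<^bsub>?A\<^esub> f) x * \<phi> x) =
          (\<Sum>y\<in>carrier H. if y = \<one>\<^bsub>H\<^esub> then (\<Sum>z\<in>carrier H. f z * \<phi> z) else 0)"
          unfolding sm one tg_elem_def by (rule sum.cong) (auto simp: norm intro!: sum.cong)
        then show "(\<Sum>x\<in>carrier H. (\<one>\<^bsub>?A\<^esub> \<otimes>\<^bsub>?A\<^esub> f) x * \<phi> x) = (\<Sum>x\<in>carrier H. f x * \<phi> x)"
          using H(2) by simp
      qed (use mc onec f in auto)
      show "f \<otimes>\<^bsub>?A\<^esub> \<one>\<^bsub>?A\<^esub> = f"
      proof (rule eqI)
        fix \<phi>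
        have "(\<Sum>x\<in>carrier H. (f \<otimes>\<^bsub>?A\<^esub> \<one>\<^bsub>?A\<^esub>) x * \<phi> x) =
          (\<Sum>y\<in>carrier H. \<Sum>z\<in>carrier H. if z = \<one>\<^bsub>H\<^esub> then f y * \<phi> y else 0)"
          unfolding sm one tg_elem_def by (intro sum.cong) (auto simp: norm)
        then show "(\<Sum>x\<in>carrier H. (f \<otimes>\<^bsub>?A\<^esub> \<one>\<^bsub>?A\<^esub>) x * \<phi> x) = (\<Sum>x\<in>carrier H. f x * \<phi> x)"
          using H(2) by simp
      qed (use mc onec f in auto)
    next
      fix f g h assume fgh: "f \<in> carrier ?A" "g \<in> carrier ?A" "h \<in> carrier ?A"
      show "(f \<otimes>\<^bsub>?A\<^esub> g) \<otimes>\<^bsub>?A\<^esub> h = f \<otimes>\<^bsub>?A\<^esub> (g \<otimes>\<^bsub>?A\<^esub> h)"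
      proof (rule eqI)
        fix \<phi> :: "'a \<Rightarrow> 'k"
        have "(\<Sum>x\<in>carrier H. ((f \<otimes>\<^bsub>?A\<^esub> g) \<otimes>\<^bsub>?A\<^esub> h) x * \<phi> x) =
          (\<Sum>w\<in>carrier H. (f \<otimes>\<^bsub>?A\<^esub> g) w * (\<Sum>z\<in>carrier H. h z * \<gamma> w z * \<phi> (w \<otimes>\<^bsub>H\<^esub> z)))"
          by (subst sm) (simp add: sum_distrib_left mult.assoc)
        also have "\<dots> = (\<Sum>a\<in>carrier H. \<Sum>b\<in>carrier H. \<Sum>z\<in>carrier H.
            f a * g b * h z * (\<gamma> a b * \<gamma> (a \<otimes>\<^bsub>H\<^esub> b) z) * \<phi> (a \<otimes>\<^bsub>H\<^esub> b \<otimes>\<^bsub>H\<^esub> z))"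
          by (subst sm) (simp add: sum_distrib_left mult_ac)
        also have "\<dots> = (\<Sum>a\<in>carrier H. \<Sum>b\<in>carrier H. \<Sum>z\<in>carrier H.
            f a * g b * h z * (\<gamma> b z * \<gamma> a (b \<otimes>\<^bsub>H\<^esub> z)) * \<phi> (a \<otimes>\<^bsub>H\<^esub> (b \<otimes>\<^bsub>H\<^esub> z)))"
          using c by (intro sum.cong) (auto simp: two_cocycle_def m_assoc)
        also have "\<dots> = (\<Sum>a\<in>carrier H. f a *
            (\<Sum>b\<in>carrier H. \<Sum>z\<in>carrier H. g b * h z * \<gamma> b z * (\<gamma> a (b \<otimes>\<^bsub>H\<^esub> z) * \<phi> (a \<otimes>\<^bsub>H\<^esub> (b \<otimes>\<^bsub>H\<^esub> z)))))"
          by (simp add: sum_distrib_left mult_ac)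
        also have "\<dots> = (\<Sum>a\<in>carrier H. f a *
            (\<Sum>w\<in>carrier H. (g \<otimes>\<^bsub>?A\<^esub> h) w * (\<gamma> a w * \<phi> (a \<otimes>\<^bsub>H\<^esub> w))))"
          by (simp only: sm)
        also have "\<dots> = (\<Sum>x\<in>carrier H. (f \<otimes>\<^bsub>?A\<^esub> (g \<otimes>\<^bsub>?A\<^esub> h)) x * \<phi> x)"
          by (subst sm) (simp add: sum_distrib_left mult_ac)
        finally show "(\<Sum>x\<in>carrier H. ((f \<otimes>\<^bsub>?A\<^esub> g) \<otimes>\<^bsub>?A\<^esub> h) x * \<phi> x) =
          (\<Sum>x\<in>carrier H. (f \<otimes>\<^bsub>?A\<^esub> (g \<otimes>\<^bsub>?A\<^esub> h)) x * \<phi> x)" .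
      qed (use mc fgh in auto)
    qed (use mc onec in auto)
  next
    fix f g h assume "f \<in> carrier ?A" "g \<in> carrier ?A" "h \<in> carrier ?A"
    then show "(f \<oplus>\<^bsub>?A\<^esub> g) \<otimes>\<^bsub>?A\<^esub> h = f \<otimes>\<^bsub>?A\<^esub> h \<oplus>\<^bsub>?A\<^esub> g \<otimes>\<^bsub>?A\<^esub> h"
      "h \<otimes>\<^bsub>?A\<^esub> (f \<oplus>\<^bsub>?A\<^esub> g) = h \<otimes>\<^bsub>?A\<^esub> f \<oplus>\<^bsub>?A\<^esub> h \<otimes>\<^bsub>?A\<^esub> g"
      by (simp_all add: twisted_group_ring_def fun_eq_iff case_prod_unfold
          distrib_left distrib_right sum.distrib)
  qed
qed

locale psi_setting =
  fixes \<Gamma> :: "('g, 'c) monoid_scheme" and G :: "('h, 'd) monoid_scheme"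
    and N :: "'g set" and lam :: "'g \<Rightarrow> 'h" and \<mu> :: "'h \<Rightarrow> 'g"
    and R :: "'k::field set" and \<beta> :: "'h \<Rightarrow> 'h \<Rightarrow> 'k" and \<chi> :: "'g \<Rightarrow> 'k"
  assumes gr: "group \<Gamma>" "finite (carrier \<Gamma>)" "group G" "finite (carrier G)"
    and lam: "lam \<in> hom \<Gamma> G" "lam ` carrier \<Gamma> = carrier G" "N = kernel \<Gamma> G lam"
    and sec: "\<mu> \<in> carrier G \<rightarrow> carrier \<Gamma>" "\<forall>g\<in>carrier G. lam (\<mu> g) = g"
      "\<mu> \<one>\<^bsub>G\<^esub> = \<one>\<^bsub>\<Gamma>\<^esub>"
    and R: "subring R \<K>"
    and \<beta>: "two_cocycle G R \<beta>"
    and \<chi>: "\<chi> \<in> hom (\<Gamma>\<lparr>carrier := N\<rparr>) (units_of \<K>)"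
    and inv: "\<forall>g\<in>carrier G. \<forall>n\<in>N. \<chi> (\<mu> g \<otimes>\<^bsub>\<Gamma>\<^esub> n \<otimes>\<^bsub>\<Gamma>\<^esub> inv\<^bsub>\<Gamma>\<^esub> (\<mu> g)) = \<chi> n"
begin

abbreviation "S \<equiv> adjoin_values R N \<chi>"
abbreviation "\<beta>\<Gamma> \<equiv> (\<lambda>x y. \<beta> (lam x) (lam y))"
abbreviation "\<beta>G \<equiv> (\<lambda>g h. \<beta> g h * \<chi> (ext_cocycle \<Gamma> G \<mu> g h))"
abbreviation "A \<equiv> twisted_group_ring \<Gamma> R \<beta>\<Gamma>"
abbreviation "B \<equiv> twisted_group_ring G S \<beta>G"
abbreviation "\<Psi> \<equiv> Psi \<Gamma> G N \<mu> \<chi>"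

sublocale \<Gamma>: group \<Gamma> by (rule gr)
sublocale G: group G by (rule gr)
sublocale lam: group_hom \<Gamma> G lam by unfold_locales (rule lam)

lemma N_iff: "n \<in> N \<longleftrightarrow> n \<in> carrier \<Gamma> \<and> lam n = \<one>\<^bsub>G\<^esub>"
  by (auto simp: lam(3) kernel_def)

lemma N_closed: "\<one>\<^bsub>\<Gamma>\<^esub> \<in> N" "m \<in> N \<Longrightarrow> n \<in> N \<Longrightarrow> m \<otimes>\<^bsub>\<Gamma>\<^esub> n \<in> N" "n \<in> N \<Longrightarrow> inv\<^bsub>\<Gamma>\<^esub> n \<in> N"
  "x \<in> carrier \<Gamma> \<Longrightarrow> n \<in> N \<Longrightarrow> x \<otimes>\<^bsub>\<Gamma>\<^esub> n \<otimes>\<^bsub>\<Gamma>\<^esub> inv\<^bsub>\<Gamma>\<^esub> x \<in> N"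
  by (auto simp: N_iff)

lemma \<mu>_closed [simp]: "g \<in> carrier G \<Longrightarrow> \<mu> g \<in> carrier \<Gamma>" "g \<in> carrier G \<Longrightarrow> lam (\<mu> g) = g"
  using sec by auto

lemma \<chi>_mult: "m \<in> N \<Longrightarrow> n \<in> N \<Longrightarrow> \<chi> (m \<otimes>\<^bsub>\<Gamma>\<^esub> n) = \<chi> m * \<chi> n"
  using \<chi> by (auto simp: hom_def units_of_def)

lemma \<chi>_nz: "n \<in> N \<Longrightarrow> \<chi> n \<noteq> 0"
  using \<chi> by (auto simp: hom_def units_of_def Units_def Pi_iff)

lemma \<chi>_one: "\<chi> \<one>\<^bsub>\<Gamma>\<^esub> = 1"
  using \<chi>_mult[of "\<one>\<^bsub>\<Gamma>\<^esub>" "\<one>\<^bsub>\<Gamma>\<^esub>"] \<chi>_nz[of "\<one>\<^bsub>\<Gamma>\<^esub>"] N_closed(1) by simp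

lemma S_subring: "subring S \<K>"
proof -
  interpret ring "\<K> :: 'k ring" by (rule type_field_ring)
  show ?thesis unfolding adjoin_values_def by (rule generate_ring_is_subring) simp
qed

lemma R_S: "r \<in> R \<Longrightarrow> r \<in> S" and \<chi>_S: "n \<in> N \<Longrightarrow> \<chi> n \<in> S"
  unfolding adjoin_values_def by (auto intro: generate_ring.incl)

lemma \<chi>_unit: "n \<in> N \<Longrightarrow> \<chi> n \<in> unit_set S"
  by (rule unit_setI[of _ _ "\<chi> (inv\<^bsub>\<Gamma>\<^esub> n)"])
    (auto simp: \<chi>_S N_closed \<chi>_mult[symmetric] \<chi>_one N_iff)

lemma unit_set_mult:
  assumes "x \<in> unit_set S" "y \<in> unit_set S"
  shows "x * y \<in> unit_set S"
proof -
  obtain x' y' where "x \<in> S" "x' \<in> S" "x * x' = 1" "y \<in> S" "y' \<in> S" "y * y' = 1"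
    using assms by (auto simp: unit_set_def Units_def)
  moreover have "x * y * (x' * y') = (x * x') * (y * y')" by (simp only: mult_ac)
  ultimately show ?thesis
    by (intro unit_setI[of _ _ "x' * y'"] subringD(4)[OF S_subring]) simp_all
qed

lemma unit_set_R_S: "x \<in> unit_set R \<Longrightarrow> x \<in> unit_set S"
  unfolding unit_set_def Units_def using R_S by auto

abbreviation "\<alpha> \<equiv> ext_cocycle \<Gamma> G \<mu>"

lemma \<alpha>_N: "g \<in> carrier G \<Longrightarrow> h \<in> carrier G \<Longrightarrow> \<alpha> g h \<in> N"
  by (auto simp: ext_cocycle_def N_iff)

lemma \<beta>\<Gamma>_cocycle: "two_cocycle \<Gamma> R \<beta>\<Gamma>"
  using \<beta> by (auto simp: two_cocycle_def)

lemma \<beta>_one: "g \<in> carrier G \<Longrightarrow> \<beta> \<one>\<^bsub>G\<^esub> g = 1" "g \<in> carrier G \<Longrightarrow> \<beta> g \<one>\<^bsub>G\<^esub> = 1"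
  using \<beta> by (auto simp: two_cocycle_def)

text \<open>The \<open>N\<close>-component of \<open>x = n \<mu>(g)\<close>.\<close>

definition comp :: "'g \<Rightarrow> 'g" where "comp x = x \<otimes>\<^bsub>\<Gamma>\<^esub> inv\<^bsub>\<Gamma>\<^esub> (\<mu> (lam x))"

lemma comp_N: "x \<in> carrier \<Gamma> \<Longrightarrow> comp x \<in> N"
  by (auto simp: comp_def N_iff)

lemma comp_eq: "x \<in> carrier \<Gamma> \<Longrightarrow> comp x \<otimes>\<^bsub>\<Gamma>\<^esub> \<mu> (lam x) = x"
  by (simp add: comp_def \<Gamma>.m_assoc)

lemma comp_mu: "n \<in> N \<Longrightarrow> g \<in> carrier G \<Longrightarrow> comp (n \<otimes>\<^bsub>\<Gamma>\<^esub> \<mu> g) = n"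
  by (simp add: comp_def N_iff \<Gamma>.m_assoc)

lemma comp_mult:
  assumes "x \<in> carrier \<Gamma>" "y \<in> carrier \<Gamma>"
  shows "comp (x \<otimes>\<^bsub>\<Gamma>\<^esub> y) =
    comp x \<otimes>\<^bsub>\<Gamma>\<^esub> (\<mu> (lam x) \<otimes>\<^bsub>\<Gamma>\<^esub> comp y \<otimes>\<^bsub>\<Gamma>\<^esub> inv\<^bsub>\<Gamma>\<^esub> \<mu> (lam x)) \<otimes>\<^bsub>\<Gamma>\<^esub> \<alpha> (lam x) (lam y)"
proof -
  have *: "inv\<^bsub>\<Gamma>\<^esub> a \<otimes>\<^bsub>\<Gamma>\<^esub> (a \<otimes>\<^bsub>\<Gamma>\<^esub> b) = b" if "a \<in> carrier \<Gamma>" "b \<in> carrier \<Gamma>" for a b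
    using that by (simp add: \<Gamma>.m_assoc[symmetric])
  show ?thesis using assms by (simp add: comp_def ext_cocycle_def \<Gamma>.m_assoc *)
qed

lemma \<chi>_comp_mult:
  assumes "x \<in> carrier \<Gamma>" "y \<in> carrier \<Gamma>"
  shows "\<chi> (comp (x \<otimes>\<^bsub>\<Gamma>\<^esub> y)) = \<chi> (comp x) * \<chi> (comp y) * \<chi> (\<alpha> (lam x) (lam y))"
  using assms inv by (simp add: comp_mult \<chi>_mult N_closed comp_N \<alpha>_N)

lemma \<beta>G_cocycle: "two_cocycle G S \<beta>G"
proof -
  have 1: "\<alpha> \<one>\<^bsub>G\<^esub> g = \<one>\<^bsub>\<Gamma>\<^esub>" "\<alpha> g \<one>\<^bsub>G\<^esub> = \<one>\<^bsub>\<Gamma>\<^esub>" if "g \<in> carrier G" for g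
    using that by (simp_all add: ext_cocycle_def sec(3))
  have c: "\<chi> (comp (\<mu> g)) = 1" if "g \<in> carrier G" for g
    using that by (simp add: comp_def \<chi>_one)
  have 2: "\<chi> (\<alpha> g h) * \<chi> (\<alpha> (g \<otimes>\<^bsub>G\<^esub> h) k) = \<chi> (\<alpha> h k) * \<chi> (\<alpha> g (h \<otimes>\<^bsub>G\<^esub> k))"
    if "g \<in> carrier G" "h \<in> carrier G" "k \<in> carrier G" for g h k
  proof -
    have "\<chi> (comp (\<mu> g \<otimes>\<^bsub>\<Gamma>\<^esub> \<mu> h \<otimes>\<^bsub>\<Gamma>\<^esub> \<mu> k)) = \<chi> (comp (\<mu> g \<otimes>\<^bsub>\<Gamma>\<^esub> (\<mu> h \<otimes>\<^bsub>\<Gamma>\<^esub> \<mu> k)))"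
      using that by (simp add: \<Gamma>.m_assoc)
    then show ?thesis using that by (simp add: \<chi>_comp_mult c)
  qed
  show ?thesis unfolding two_cocycle_def
  proof (intro conjI ballI)
    fix g h k assume g: "g \<in> carrier G" "h \<in> carrier G" "k \<in> carrier G"
    then have b: "\<beta> g h * \<beta> (g \<otimes>\<^bsub>G\<^esub> h) k = \<beta> h k * \<beta> g (h \<otimes>\<^bsub>G\<^esub> k)"
      using \<beta> by (simp add: two_cocycle_def)
    have *: "(a * b) * (c * d) = (a * c) * (b * d)" for a b c d :: 'k
      by (simp add: mult_ac)
    show "\<beta>G g h * \<beta>G (g \<otimes>\<^bsub>G\<^esub> h) k = \<beta>G h k * \<beta>G g (h \<otimes>\<^bsub>G\<^esub> k)"
      by (simp only: * b 2[OF g])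
  next
    fix g h assume "g \<in> carrier G" "h \<in> carrier G"
    then show "\<beta>G g h \<in> unit_set S"
      using \<beta> by (auto simp: two_cocycle_def intro!: unit_set_mult \<chi>_unit \<alpha>_N intro: unit_set_R_S)
  qed (simp_all add: \<beta>_one 1 \<chi>_one)
qed

lemma Psi_sum:
  "(\<Sum>g\<in>carrier G. \<Psi> f g * \<phi> g) = (\<Sum>x\<in>carrier \<Gamma>. f x * \<chi> (comp x) * \<phi> (lam x))"
proof -
  have "(\<Sum>g\<in>carrier G. \<Psi> f g * \<phi> g) =
      (\<Sum>(g, n)\<in>carrier G \<times> N. f (n \<otimes>\<^bsub>\<Gamma>\<^esub> \<mu> g) * \<chi> n * \<phi> g)"
    by (simp add: Psi_def sum_distrib_right sum.cartesian_product)
  also have "\<dots> = (\<Sum>x\<in>carrier \<Gamma>. f x * \<chi> (comp x) * \<phi> (lam x))"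
    by (rule sum.reindex_bij_witness[of _ "\<lambda>x. (lam x, comp x)" "\<lambda>(g, n). n \<otimes>\<^bsub>\<Gamma>\<^esub> \<mu> g"])
      (auto simp: comp_eq comp_mu comp_N, auto simp: N_iff)
  finally show ?thesis .
qed

lemma Psi_closed:
  assumes "f \<in> carrier A"
  shows "\<Psi> f \<in> carrier B"
proof -
  have "f x \<in> R" if "x \<in> carrier \<Gamma>" for x
    using assms that by (simp add: twisted_group_ring_def)
  then have "(\<Sum>n\<in>N. f (n \<otimes>\<^bsub>\<Gamma>\<^esub> \<mu> g) * \<chi> n) \<in> S" if "g \<in> carrier G" for g
    using that by (intro subring_sum[OF S_subring] subringD(4)[OF S_subring] R_S \<chi>_S) (simp_all add: N_iff)
  then show ?thesis by (simp add: Psi_def twisted_group_ring_def)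
qed

lemma Psi_tg_elem:
  assumes "r \<in> R" "n \<in> N" "g \<in> carrier G"
  shows "\<Psi> (tg_elem r (n \<otimes>\<^bsub>\<Gamma>\<^esub> \<mu> g)) = tg_elem (r * \<chi> n) g"
proof (rule tg_eqI[OF gr(4), of _ S \<beta>G])
  have ng: "n \<otimes>\<^bsub>\<Gamma>\<^esub> \<mu> g \<in> carrier \<Gamma>" "lam (n \<otimes>\<^bsub>\<Gamma>\<^esub> \<mu> g) = g"
    using assms by (auto simp: N_iff)
  show "\<Psi> (tg_elem r (n \<otimes>\<^bsub>\<Gamma>\<^esub> \<mu> g)) \<in> carrier B"
    by (intro Psi_closed tg_elem_closed R assms ng)
  show "tg_elem (r * \<chi> n) g \<in> carrier B"
    by (intro tg_elem_closed S_subring assms subringD(4)[OF S_subring] R_S \<chi>_S)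
  fix \<phi> :: "'h \<Rightarrow> 'k"
  show "(\<Sum>x\<in>carrier G. \<Psi> (tg_elem r (n \<otimes>\<^bsub>\<Gamma>\<^esub> \<mu> g)) x * \<phi> x) =
      (\<Sum>x\<in>carrier G. tg_elem (r * \<chi> n) g x * \<phi> x)"
    unfolding Psi_sum tg_elem_def using assms gr ng
    by (simp add: if_distrib[of "\<lambda>t. t * _"] comp_mu cong: if_cong)
qed

lemma Psi_ring_hom: "\<Psi> \<in> Ring.ring_hom A B"
proof (rule ring_hom_memI)
  fix f f' assume f: "f \<in> carrier A" "f' \<in> carrier A"
  show "\<Psi> (f \<otimes>\<^bsub>A\<^esub> f') = \<Psi> f \<otimes>\<^bsub>B\<^esub> \<Psi> f'"
  proof (rule tg_eqI[OF gr(4), of _ S \<beta>G])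
    fix \<phi> :: "'h \<Rightarrow> 'k"
    have "(\<Sum>g\<in>carrier G. \<Psi> (f \<otimes>\<^bsub>A\<^esub> f') g * \<phi> g) =
      (\<Sum>x\<in>carrier \<Gamma>. (f \<otimes>\<^bsub>A\<^esub> f') x * (\<chi> (comp x) * \<phi> (lam x)))"
      by (simp add: Psi_sum mult.assoc)
    also have "\<dots> = (\<Sum>x\<in>carrier \<Gamma>. \<Sum>y\<in>carrier \<Gamma>. f x * f' y * \<beta>\<Gamma> x y *
        (\<chi> (comp (x \<otimes>\<^bsub>\<Gamma>\<^esub> y)) * \<phi> (lam (x \<otimes>\<^bsub>\<Gamma>\<^esub> y))))"
      by (rule tg_sum_mult[OF gr(1,2)])
    also have "\<dots> = (\<Sum>x\<in>carrier \<Gamma>. f x * \<chi> (comp x) *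
        (\<Sum>y\<in>carrier \<Gamma>. f' y * \<chi> (comp y) * (\<beta>G (lam x) (lam y) * \<phi> (lam x \<otimes>\<^bsub>G\<^esub> lam y))))"
      by (auto simp: \<chi>_comp_mult sum_distrib_left mult_ac intro!: sum.cong)
    also have "\<dots> = (\<Sum>g\<in>carrier G. \<Psi> f g *
        (\<Sum>h\<in>carrier G. \<Psi> f' h * (\<beta>G g h * \<phi> (g \<otimes>\<^bsub>G\<^esub> h))))"
      unfolding Psi_sum by (rule refl)
    also have "\<dots> = (\<Sum>g\<in>carrier G. (\<Psi> f \<otimes>\<^bsub>B\<^esub> \<Psi> f') g * \<phi> g)"
      unfolding tg_sum_mult[OF gr(3,4)] by (simp add: sum_distrib_left mult_ac)
    finally show "(\<Sum>g\<in>carrier G. \<Psi> (f \<otimes>\<^bsub>A\<^esub> f') g * \<phi> g) =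
      (\<Sum>g\<in>carrier G. (\<Psi> f \<otimes>\<^bsub>B\<^esub> \<Psi> f') g * \<phi> g)" .
  qed (intro Psi_closed tg_mult_closed gr R S_subring \<beta>\<Gamma>_cocycle \<beta>G_cocycle f)+
  show "\<Psi> (f \<oplus>\<^bsub>A\<^esub> f') = \<Psi> f \<oplus>\<^bsub>B\<^esub> \<Psi> f'"
    by (simp add: Psi_def twisted_group_ring_def fun_eq_iff distrib_right sum.distrib)
next
  have "\<Psi> (tg_elem 1 (\<one>\<^bsub>\<Gamma>\<^esub> \<otimes>\<^bsub>\<Gamma>\<^esub> \<mu> \<one>\<^bsub>G\<^esub>)) = tg_elem (1 * \<chi> \<one>\<^bsub>\<Gamma>\<^esub>) \<one>\<^bsub>G\<^esub>"
    by (rule Psi_tg_elem) (simp_all add: subringD[OF R] N_closed)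
  then show "\<Psi> \<one>\<^bsub>A\<^esub> = \<one>\<^bsub>B\<^esub>" by (simp add: twisted_group_ring_def sec(3) \<chi>_one)
qed (rule Psi_closed)

lemma S_span: "s \<in> S \<Longrightarrow> \<exists>c. c ` N \<subseteq> R \<and> s = (\<Sum>n\<in>N. c n * \<chi> n)"
proof -
  have fin: "finite N" using gr(2) by (rule rev_finite_subset) (auto simp: N_iff)
  have base: "\<exists>c. c ` N \<subseteq> R \<and> r * \<chi> m = (\<Sum>n\<in>N. c n * \<chi> n)" if "r \<in> R" "m \<in> N" for r m
    using that fin subringD[OF R]
    by (intro exI[of _ "\<lambda>n. if n = m then r else 0"]) (auto simp: if_distrib[of "\<lambda>t. t * _"] cong: if_cong)
  have neg1: "- 1 \<in> R" using subringD[OF R] by blast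
  show "\<exists>c. c ` N \<subseteq> R \<and> s = (\<Sum>n\<in>N. c n * \<chi> n)" if "s \<in> S"
    using that unfolding adjoin_values_def
  proof (induction rule: generate_ring.induct)
    case one
    then show ?case using base[of 1 "\<one>\<^bsub>\<Gamma>\<^esub>"] subringD[OF R] by (simp add: \<chi>_one N_closed)
  next
    case (incl h)
    then show ?case
      using base[of h "\<one>\<^bsub>\<Gamma>\<^esub>"] base[of 1] subringD[OF R] by (auto simp: \<chi>_one N_closed)
  next
    case (a_inv h)
    then obtain c where "c ` N \<subseteq> R" "h = (\<Sum>n\<in>N. c n * \<chi> n)" by blast
    then show ?case using subringD[OF R]
      by (intro exI[of _ "\<lambda>n. - c n"]) (auto simp: sum_negf)
  next
    case (eng_add h k)
    then obtain c d where "c ` N \<subseteq> R" "h = (\<Sum>n\<in>N. c n * \<chi> n)"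
      "d ` N \<subseteq> R" "k = (\<Sum>n\<in>N. d n * \<chi> n)" by blast
    then show ?case using subringD[OF R]
      by (intro exI[of _ "\<lambda>n. c n + d n"]) (auto simp: sum.distrib distrib_right image_subset_iff)
  next
    case (eng_mult h k)
    then obtain c d where c: "c ` N \<subseteq> R" "h = (\<Sum>n\<in>N. c n * \<chi> n)"
      "d ` N \<subseteq> R" "k = (\<Sum>n\<in>N. d n * \<chi> n)" by blast
    define e where "e l = (\<Sum>m\<in>N. c m * d (inv\<^bsub>\<Gamma>\<^esub> m \<otimes>\<^bsub>\<Gamma>\<^esub> l))" for l
    have "e ` N \<subseteq> R"
      using c(1,3) by (auto simp: e_def N_closed image_subset_iff
          intro!: subring_sum[OF R] subringD(4)[OF R])
    moreover have "h * k = (\<Sum>l\<in>N. e l * \<chi> l)"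
    proof -
      have "(\<Sum>l\<in>N. e l * \<chi> l) = (\<Sum>m\<in>N. \<Sum>l\<in>N. c m * d (inv\<^bsub>\<Gamma>\<^esub> m \<otimes>\<^bsub>\<Gamma>\<^esub> l) * \<chi> l)"
        unfolding e_def sum_distrib_right by (rule sum.swap)
      also have "\<dots> = (\<Sum>m\<in>N. \<Sum>n\<in>N. c m * d n * \<chi> (m \<otimes>\<^bsub>\<Gamma>\<^esub> n))"
      proof (rule sum.cong[OF refl])
        fix m assume m: "m \<in> N"
        then have mc: "m \<in> carrier \<Gamma>" by (simp add: N_iff)
        have *: "m \<otimes>\<^bsub>\<Gamma>\<^esub> (inv\<^bsub>\<Gamma>\<^esub> m \<otimes>\<^bsub>\<Gamma>\<^esub> a) = a" "inv\<^bsub>\<Gamma>\<^esub> m \<otimes>\<^bsub>\<Gamma>\<^esub> (m \<otimes>\<^bsub>\<Gamma>\<^esub> a) = a"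
          if "a \<in> N" for a
          using that mc by (simp_all add: N_iff \<Gamma>.m_assoc[symmetric])
        show "(\<Sum>l\<in>N. c m * d (inv\<^bsub>\<Gamma>\<^esub> m \<otimes>\<^bsub>\<Gamma>\<^esub> l) * \<chi> l) = (\<Sum>n\<in>N. c m * d n * \<chi> (m \<otimes>\<^bsub>\<Gamma>\<^esub> n))"
          by (rule sum.reindex_bij_witness[of _ "\<lambda>n. m \<otimes>\<^bsub>\<Gamma>\<^esub> n" "\<lambda>l. inv\<^bsub>\<Gamma>\<^esub> m \<otimes>\<^bsub>\<Gamma>\<^esub> l"])
            (use m in \<open>auto simp: N_closed *\<close>)
      qed
      also have "\<dots> = h * k"
        by (simp add: c sum_product \<chi>_mult mult_ac)
      finally show ?thesis by simp
    qed
    ultimately show ?case by auto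
  qed
qed

lemma Psi_surj: "\<Psi> ` carrier A = carrier B"
proof
  show "\<Psi> ` carrier A \<subseteq> carrier B" using Psi_closed by blast
  show "carrier B \<subseteq> \<Psi> ` carrier A"
  proof
    fix f assume f: "f \<in> carrier B"
    then have "\<forall>g\<in>carrier G. \<exists>c. c ` N \<subseteq> R \<and> f g = (\<Sum>n\<in>N. c n * \<chi> n)"
      using S_span by (auto simp: twisted_group_ring_def)
    then obtain c where c: "\<And>g. g \<in> carrier G \<Longrightarrow> c g ` N \<subseteq> R \<and> f g = (\<Sum>n\<in>N. c g n * \<chi> n)"
      by metis
    define f' where "f' x = (if x \<in> carrier \<Gamma> then c (lam x) (comp x) else 0)" for x
    have "f' \<in> carrier A"
      using c by (auto simp: f'_def twisted_group_ring_def image_subset_iff comp_N)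
    moreover have "\<Psi> f' = f"
      using f c by (auto simp: Psi_def f'_def fun_eq_iff N_iff comp_mu twisted_group_ring_def intro!: sum.cong)
    ultimately show "f \<in> \<Psi> ` carrier A" by blast
  qed
qed

end

end

theory Submission
  imports Defs
begin

text \<open>
  (1) By Maschke's argument there are \<open>m > 0\<close> and \<open>e \<in> R[N]\<close> with \<open>\<Psi> e = m\<close> and \<open>e \<cdot> ker \<Psi> = 0\<close>. If
  \<open>1 + m c\<close> and \<open>1 + m c'\<close> are mutually inverse units and \<open>\<Psi> a = c\<close>, \<open>\<Psi> a' = c'\<close>, then
  \<open>(1 + e a) (1 + e a') = 1 + e (a + a' + a e a')\<close>, where the bracket lies in \<open>ker \<Psi>\<close>; so \<open>1 + m c\<close>
  is in the image. Units that agree modulo \<open>m\<close> thus lie in the same coset, and there are finitely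
  many residues modulo \<open>m\<close>.

  (2) Berman--Higman: if \<open>f\<close> is a torsion unit whose coefficient \<open>x\<close> at \<open>1\<close> is nonzero, then \<open>x\<close> is an
  average of roots of unity. All powers of \<open>x\<close> are such averages and lie in the lattice \<open>R\<close>; in
  rational coordinates they are bounded with bounded denominators, so there are finitely many and
  \<open>x\<close> is a root of unity. An average of roots of unity is a root of unity only if all of them are
  equal, hence \<open>f\<close> is a scalar. A torsion unit \<open>u\<close> with \<open>\<Psi> u = 1\<close> has a nonzero coefficient at some
  \<open>a \<in> N\<close>; apply this to \<open>u\<close> times the inverse of the central element \<open>u\<^sub>a\<close>.
\<close>

section \<open>Rational and integral linear combinations in a field of characteristic 0\<close>

interpretation rat_space: vector_space "\<lambda>q x. of_rat q * (x :: 'a::field_char_0)"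
  by unfold_locales (simp_all add: algebra_simps of_rat_add of_rat_mult)

interpretation int_module: Modules.module "\<lambda>m x. of_int m * (x :: 'a::field_char_0)"
  by unfold_locales (simp_all add: algebra_simps)

section \<open>Weighted sums of roots of unity\<close>

text \<open>The total weight adds under sums and multiplies under products. It takes over the role
  of an absolute value, which an abstract field of characteristic 0 does not come with. The weight
  belongs to the derivation: the same element can carry several.\<close>

inductive weighted_sum :: "'a::field_char_0 set \<Rightarrow> rat \<Rightarrow> 'a \<Rightarrow> bool" for Z where
  zero: "weighted_sum Z 0 0"
| insert: "weighted_sum Z m x \<Longrightarrow> z \<in> Z \<Longrightarrow> q \<ge> 0 \<Longrightarrow> weighted_sum Z (m + q) (x + of_rat q * z)"

lemma weighted_sum_add:
  assumes "weighted_sum Z m x" "weighted_sum Z m' x'"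
  shows "weighted_sum Z (m + m') (x + x')"
  using assms(2)
proof induction
  case (insert m' x' z q)
  then show ?case using weighted_sum.insert[of Z "m + m'" "x + x'" z q] by (simp add: add.assoc)
qed (use assms(1) in simp)

lemma weighted_sum_single: "z \<in> Z \<Longrightarrow> q \<ge> 0 \<Longrightarrow> weighted_sum Z q (of_rat q * z)"
  using weighted_sum.insert[OF weighted_sum.zero, of z Z q] by simp

lemma weighted_sum_sum:
  assumes "\<And>i. i \<in> I \<Longrightarrow> weighted_sum Z (m i) (x i)"
  shows "weighted_sum Z (sum m I) (sum x I)"
  using assms
  by (induction I rule: infinite_finite_induct) (auto intro: weighted_sum.zero weighted_sum_add)

lemma weighted_sum_scale:
  assumes "weighted_sum Z m x" "q \<ge> 0"
  shows "weighted_sum Z (q * m) (of_rat q * x)"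
  using assms(1)
proof induction
  case (insert m x z p)
  then show ?case
    using assms(2) weighted_sum.insert[of Z "q * m" "of_rat q * x" z "q * p"]
    by (simp add: algebra_simps of_rat_mult)
qed (simp add: weighted_sum.zero)

text \<open>Multiplying by a single element of \<open>Z\<close> keeps every term over
  \<open>Z\<close> with its weight; the general case follows by distributivity.\<close>

lemma weighted_sum_mult:
  assumes Z: "\<And>y z. y \<in> Z \<Longrightarrow> z \<in> Z \<Longrightarrow> y * z \<in> Z"
    and "weighted_sum Z m x" "weighted_sum Z m' x'"
  shows "weighted_sum Z (m * m') (x * x')"
proof -
  have single: "weighted_sum Z m (z * x)" if "z \<in> Z" for z
    using assms(2)
  proof induction
    case (insert m x y q)
    then show ?case
      using that Z weighted_sum.insert[of Z m "z * x" "z * y" q] by (simp add: algebra_simps)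
  qed (simp add: weighted_sum.zero)
  show ?thesis using assms(3)
  proof induction
    case (insert m' x' z q)
    have "weighted_sum Z (q * m) (of_rat q * (z * x))"
      by (intro weighted_sum_scale single insert)
    from weighted_sum_add[OF insert.IH this] show ?case by (simp add: algebra_simps)
  qed (simp add: weighted_sum.zero)
qed

lemma weighted_sum_power:
  assumes "\<And>y z. y \<in> Z \<Longrightarrow> z \<in> Z \<Longrightarrow> y * z \<in> Z" "1 \<in> Z" "weighted_sum Z m x"
  shows "weighted_sum Z (m ^ t) (x ^ t)"
  by (induction t) (use assms weighted_sum_single[of 1 Z 1] in \<open>auto intro: weighted_sum_mult\<close>)

text \<open>The triangle inequality, with the sum of all \<open>\<bar>\<phi> z\<bar>\<close> as
  \<open>C\<close>. What matters is that one \<open>C\<close> serves all weights at once.\<close>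

lemma weighted_sum_bounded:
  fixes \<phi> :: "'a::field_char_0 \<Rightarrow> rat"
  assumes "finite Z" "Vector_Spaces.linear (\<lambda>q x. of_rat q * x) (*) \<phi>"
  obtains C where "\<And>m x. weighted_sum Z m x \<Longrightarrow> \<bar>\<phi> x\<bar> \<le> C * m"
proof
  interpret \<phi>: Vector_Spaces.linear "\<lambda>q x. of_rat q * x :: 'a" "(*)" \<phi> by fact
  fix m x assume "weighted_sum Z m x"
  then show "\<bar>\<phi> x\<bar> \<le> (\<Sum>z\<in>Z. \<bar>\<phi> z\<bar>) * m"
  proof induction
    case (insert m x z q)
    have "\<bar>\<phi> (x + of_rat q * z)\<bar> \<le> \<bar>\<phi> x\<bar> + q * \<bar>\<phi> z\<bar>"
      using insert(3) abs_triangle_ineq[of "\<phi> x" "q * \<phi> z"] by (simp add: \<phi>.add \<phi>.scale abs_mult)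
    also have "\<dots> \<le> (\<Sum>z\<in>Z. \<bar>\<phi> z\<bar>) * m + q * (\<Sum>z\<in>Z. \<bar>\<phi> z\<bar>)"
      using insert assms(1) by (intro add_mono mult_left_mono member_le_sum) auto
    finally show ?case by (simp add: algebra_simps)
  qed (simp add: \<phi>.zero)
qed

text \<open>The coordinate at \<open>b\<close> for a rational basis of the whole field extending
  \<open>B\<close>. It is thus defined on all weighted sums, not just on the span of
  \<open>B\<close>.\<close>

lemma rat_functional_exists:
  assumes "rat_space.independent B" "b \<in> B"
  obtains \<phi> :: "'a::field_char_0 \<Rightarrow> rat"
  where "Vector_Spaces.linear (\<lambda>q x. of_rat q * x) (*) \<phi>" "\<And>c. c \<in> B \<Longrightarrow> \<phi> c = (if c = b then 1 else 0)"
proof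
  let ?E = "rat_space.extend_basis B"
  let ?\<phi> = "\<lambda>v. rat_space.representation ?E v b"
  have E: "rat_space.independent ?E" "rat_space.span ?E = UNIV" "B \<subseteq> ?E"
    using assms(1) by (rule rat_space.independent_extend_basis rat_space.span_extend_basis
        rat_space.extend_basis_superset)+
  show "Vector_Spaces.linear (\<lambda>q x. of_rat q * x) (*) ?\<phi>"
    using rat_space.linear_representation[OF E(1,2)] .
  show "?\<phi> c = (if c = b then 1 else 0)" if "c \<in> B" for c
    using rat_space.representation_basis[OF E(1), of c] E(3) that by auto
qed

section \<open>Finiteness of lattice points of given weight\<close>

lemma finite_bounded_denominator:
  assumes "D > 0"
  shows "finite {q :: rat. of_nat D * q \<in> \<int> \<and> \<bar>q\<bar> \<le> C}"
proof (rule finite_subset)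
  let ?M = "\<lceil>of_nat D * C\<rceil>"
  show "{q :: rat. of_nat D * q \<in> \<int> \<and> \<bar>q\<bar> \<le> C} \<subseteq> (\<lambda>m. of_int m / of_nat D) ` {-?M..?M}"
  proof
    fix q :: rat assume "q \<in> {q. of_nat D * q \<in> \<int> \<and> \<bar>q\<bar> \<le> C}"
    then obtain m where m: "of_nat D * q = of_int m" and q: "\<bar>q\<bar> \<le> C" by (auto elim: Ints_cases)
    have "\<bar>of_int m :: rat\<bar> \<le> of_nat D * C"
      unfolding m[symmetric] using q by (simp add: abs_mult mult_left_mono)
    then have "\<bar>m\<bar> \<le> ?M" by (metis ceiling_mono ceiling_of_int of_int_abs)
    moreover have "q = of_int m / of_nat D" using m assms by (simp add: field_simps)
    ultimately show "q \<in> (\<lambda>m. of_int m / of_nat D) ` {-?M..?M}" by (intro image_eqI[of _ _ m]) auto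
  qed
qed simp

lemma common_denominator:
  fixes f :: "'i \<Rightarrow> rat"
  assumes "finite I"
  obtains D :: nat where "D > 0" "\<And>i. i \<in> I \<Longrightarrow> of_nat D * f i \<in> \<int>"
proof -
  have "\<exists>D>0. \<forall>i\<in>I. of_nat D * f i \<in> \<int>"
    using assms
  proof induction
    case (insert i I)
    then obtain D where D: "D > 0" "\<forall>i\<in>I. of_nat D * f i \<in> \<int>" by blast
    obtain a b where ab: "f i = of_int a / of_int b" "b > 0"
      by (metis quotient_of_denom_pos' quotient_of_div surjective_pairing)
    have "of_nat (nat b * D) * f j \<in> \<int>" if "j \<in> insert i I" for j
    proof (cases "j = i")
      case True
      have "of_nat (nat b * D) * f j = of_int (int D * a)" using ab True by simp
      then show ?thesis by (metis Ints_of_int)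
    next
      case False
      then have "of_nat D * f j \<in> \<int>" using that D(2) by blast
      then have "of_nat (nat b) * (of_nat D * f j) \<in> \<int>" by (rule Ints_mult[OF Ints_of_nat])
      then show ?thesis by (simp add: mult.assoc)
    qed
    then show ?case using D(1) ab(2) by (intro exI[of _ "nat b * D"]) simp
  qed (intro exI[of _ 1], simp)
  then show ?thesis using that by blast
qed

text \<open>
  In coordinates, lattice points have bounded denominators and weighted sums of fixed
  total weight are bounded.
\<close>

lemma finite_lattice_weighted_sum:
  fixes B Z :: "'a::field_char_0 set"
  assumes "finite B" "finite Z"
  shows "finite {x \<in> int_module.span B. weighted_sum Z m x}"
proof -
  \<comment> \<open>The generators may be linearly dependent over the rationals, so a rational basis
    is chosen among them. The remaining generators then have fractional coordinates, with common
    denominator \<open>D\<close> below.\<close>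
  obtain b where b: "b \<subseteq> B" "rat_space.independent b" "B \<subseteq> rat_space.span b"
    using rat_space.maximal_independent_subset[of B] by blast
  have fb: "finite b" using b(1) assms(1) finite_subset by blast
  have "\<forall>c\<in>b. \<exists>\<phi>. Vector_Spaces.linear (\<lambda>q x. of_rat q * (x :: 'a)) (*) \<phi> \<and> (\<forall>d\<in>b. \<phi> d = (if d = c then 1 else 0))"
    using rat_functional_exists[OF b(2)] by metis
  then obtain \<phi> where \<phi>: "\<And>c. c \<in> b \<Longrightarrow> Vector_Spaces.linear (\<lambda>q x. of_rat q * (x :: 'a)) (*) (\<phi> c)"
    "\<And>c d. c \<in> b \<Longrightarrow> d \<in> b \<Longrightarrow> \<phi> c d = (if d = c then 1 else 0)" by metis
  obtain D where D: "D > 0" "\<And>i. i \<in> b \<times> B \<Longrightarrow> of_nat D * (\<lambda>(c, y). \<phi> c y) i \<in> \<int>"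
    using common_denominator[of "b \<times> B" "\<lambda>(c, y). \<phi> c y"] fb assms(1) by (metis finite_SigmaI)
  have "\<forall>c\<in>b. \<exists>C. \<forall>m x. weighted_sum Z m x \<longrightarrow> \<bar>\<phi> c x\<bar> \<le> C * m"
    using weighted_sum_bounded[OF assms(2) \<phi>(1)] by metis
  then obtain C where C: "\<And>c m x. c \<in> b \<Longrightarrow> weighted_sum Z m x \<Longrightarrow> \<bar>\<phi> c x\<bar> \<le> C c * m" by metis
  have span: "x \<in> rat_space.span b \<and> (\<forall>c\<in>b. of_nat D * \<phi> c x \<in> \<int>)" if "x \<in> int_module.span B" for x
    using that
  proof (induction rule: int_module.span_induct_alt)
    case base
    have "\<phi> c 0 = 0" if c: "c \<in> b" for c
    proof -
      interpret \<phi>: Vector_Spaces.linear "\<lambda>q x. of_rat q * x :: 'a" "(*)" "\<phi> c" using \<phi>(1)[OF c] .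
      show ?thesis by (rule \<phi>.zero)
    qed
    then show ?case by (simp add: rat_space.span_zero)
  next
    case (step k x y)
    have "of_rat (of_int k) * x + y \<in> rat_space.span b"
      using step b(3) by (intro rat_space.span_add rat_space.span_scale) auto
    moreover have "of_nat D * \<phi> c (of_int k * x + y) \<in> \<int>" if c: "c \<in> b" for c
    proof -
      interpret \<phi>: Vector_Spaces.linear "\<lambda>q x. of_rat q * x :: 'a" "(*)" "\<phi> c" using \<phi>(1)[OF c] .
      have "\<phi> c (of_int k * x + y) = of_int k * \<phi> c x + \<phi> c y"
        using \<phi>.scale[of "of_int k" x] by (simp add: \<phi>.add)
      then have eq: "of_nat D * \<phi> c (of_int k * x + y) =
          of_int k * (of_nat D * \<phi> c x) + of_nat D * \<phi> c y"
        by (simp only: distrib_left mult.left_commute)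
      have "of_nat D * \<phi> c x \<in> \<int>" "of_nat D * \<phi> c y \<in> \<int>"
        using D(2)[of "(c, x)"] c step by auto
      then show ?thesis unfolding eq by (rule Ints_add[OF Ints_mult[OF Ints_of_int]])
    qed
    ultimately show ?case by simp
  qed
  have inj: "x = (\<Sum>c\<in>b. of_rat (\<phi> c x) * c)" if x: "x \<in> rat_space.span b" for x
  proof -
    obtain u where u: "x = (\<Sum>c\<in>b. of_rat (u c) * c)"
      using x rat_space.span_finite[OF fb] by auto
    have "\<phi> c x = u c" if c: "c \<in> b" for c
    proof -
      interpret \<phi>: Vector_Spaces.linear "\<lambda>q x. of_rat q * x :: 'a" "(*)" "\<phi> c" using \<phi>(1)[OF c] .
      show ?thesis unfolding u \<phi>.sum \<phi>.scale using \<phi>(2)[OF c] c fb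
        by (simp add: if_distrib[of "\<lambda>t. _ * t"] cong: if_cong)
    qed
    then show ?thesis using u by simp
  qed
  let ?P = "\<Pi>\<^sub>E c\<in>b. {q. of_nat D * q \<in> \<int> \<and> \<bar>q\<bar> \<le> C c * m}"
  show ?thesis
  proof (rule finite_subset)
    show "finite ((\<lambda>f. \<Sum>c\<in>b. of_rat (f c) * c) ` ?P)"
      using fb finite_bounded_denominator[OF D(1)] by (intro finite_imageI finite_PiE) auto
    show "{x \<in> int_module.span B. weighted_sum Z m x} \<subseteq> (\<lambda>f. \<Sum>c\<in>b. of_rat (f c) * c) ` ?P"
    proof
      fix x assume "x \<in> {x \<in> int_module.span B. weighted_sum Z m x}"
      then have x: "x \<in> int_module.span B" "weighted_sum Z m x" by auto
      show "x \<in> (\<lambda>f. \<Sum>c\<in>b. of_rat (f c) * c) ` ?P"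
      proof (rule image_eqI)
        show "x = (\<Sum>c\<in>b. of_rat (restrict (\<lambda>c. \<phi> c x) b c) * c)"
          using inj span[OF x(1)] by simp
        show "restrict (\<lambda>c. \<phi> c x) b \<in> ?P" using span[OF x(1)] C[OF _ x(2)] by auto
      qed
    qed
  qed
qed

text \<open>Weight 1 is preserved by powers, so all powers of \<open>x\<close> lie in one finite set
  and two of them coincide.\<close>

lemma root_of_unity_if_weighted_sum:
  fixes x :: "'a::field_char_0"
  assumes B: "finite B" "\<And>t. x ^ t \<in> int_module.span B"
    and Z: "finite Z" "\<And>y z. y \<in> Z \<Longrightarrow> z \<in> Z \<Longrightarrow> y * z \<in> Z" "1 \<in> Z"
    and x: "weighted_sum Z 1 x" "x \<noteq> 0"
  obtains t where "t > 0" "x ^ t = 1"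
proof -
  have "range (\<lambda>t. x ^ t) \<subseteq> {x \<in> int_module.span B. weighted_sum Z 1 x}"
    using weighted_sum_power[OF Z(2,3) x(1)] B(2) by auto
  then have "finite (range (\<lambda>t. x ^ t))"
    using finite_lattice_weighted_sum[OF B(1) Z(1)] finite_subset by blast
  then have "\<not> inj (\<lambda>t. x ^ t)" using finite_imageD infinite_UNIV_nat by blast
  then obtain s t where st: "x ^ s = x ^ t" "s < t" unfolding inj_def by (metis linorder_neqE_nat)
  have "x ^ s * x ^ (t - s) = x ^ t" using st(2) by (simp add: power_add[symmetric])
  then show ?thesis using that[of "t - s"] st x(2) by simp
qed

lemma sum_powers_root_of_unity:
  fixes a :: "'a::field"
  assumes "a ^ k = 1" "a \<noteq> 1"
  shows "(\<Sum>t<k. a ^ t) = 0"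
  using assms geometric_sum[of a k] by simp

text \<open>
  If \<open>a \<noteq> 1\<close> occurred with positive weight in \<open>1\<close>, then cancelling \<open>1 + a + \<dots> + a\<^sup>k\<^sup>-\<^sup>1 = 0\<close> would
  write \<open>1\<close> with total weight \<open>r < 1\<close>, hence with total weight \<open>r\<^sup>t\<close> for every \<open>t\<close>, against boundedness.
\<close>

lemma weighted_sum_one_extreme:
  fixes Z :: "'a::field_char_0 set"
  assumes Z: "finite Z" "\<And>y z. y \<in> Z \<Longrightarrow> z \<in> Z \<Longrightarrow> y * z \<in> Z" "1 \<in> Z"
    and a: "a \<in> Z" "a \<noteq> 1" "a ^ k = 1" "k > 0"
    and p: "p \<ge> 0" "weighted_sum Z (1 - p) (1 - of_rat p * a)"
  shows "p = 0"
proof (rule ccontr)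
  assume "p \<noteq> 0"
  then have p0: "p > 0" using p(1) by simp
  obtain \<phi> :: "'a \<Rightarrow> rat" where \<phi>: "Vector_Spaces.linear (\<lambda>q x. of_rat q * x) (*) \<phi>" "\<phi> 1 = 1"
    using rat_functional_exists[of "{1 :: 'a}" 1] by (auto simp: rat_space.independent_insert)
  obtain C where C: "\<And>m x. weighted_sum Z m x \<Longrightarrow> \<bar>\<phi> x\<bar> \<le> C * m"
    using weighted_sum_bounded[OF Z(1) \<phi>(1)] by blast
  have p1: "p \<le> 1"
  proof -
    have "m \<ge> 0" if "weighted_sum Z m x" for m x using that by induction auto
    from this[OF p(2)] show ?thesis by simp
  qed
  have at: "a ^ t \<in> Z" for t by (induction t) (use Z a in auto)
  \<comment> \<open>Iterates the hypothesis through
    \<open>1 - p^(t+1) a^(t+1) = (1 - p a) + p a (1 - p^t a^t)\<close>, which exhibits positive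
    weight on every power of \<open>a\<close>.\<close>
  have pow: "weighted_sum Z (1 - p ^ t) (1 - of_rat (p ^ t) * a ^ t)" for t
  proof (induction t)
    case (Suc t)
    have "weighted_sum Z (1 * (p * (1 - p ^ t))) (a * (of_rat p * (1 - of_rat (p ^ t) * a ^ t)))"
      using weighted_sum_single[OF a(1), of 1] p0
      by (intro weighted_sum_mult Z weighted_sum_scale Suc) auto
    from weighted_sum_add[OF p(2) this] show ?case
      by (simp add: algebra_simps of_rat_mult)
  qed (simp add: weighted_sum.zero)
  \<comment> \<open>Since \<open>p \<le> 1\<close>, \<open>q\<close> is a lower bound of all
    \<open>p ^ t\<close> with \<open>t < k\<close>. So the same weight \<open>q\<close> can be set
    aside at each power of \<open>a\<close>, and these parts cancel when summed over
    \<open>t\<close>.\<close>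
  define q where "q = p ^ k"
  have q: "0 < q" "q \<le> 1" using p0 p1 by (auto simp: q_def power_le_one)
  have "weighted_sum Z (1 - q) (1 - of_rat q * a ^ t)" if "t < k" for t
  proof -
    have "weighted_sum Z (p ^ t - q) (of_rat (p ^ t - q) * a ^ t)"
      using that p0 p1 by (intro weighted_sum_single at) (simp add: q_def power_decreasing)
    from weighted_sum_add[OF pow[of t] this] show ?thesis
      by (simp add: algebra_simps of_rat_diff)
  qed
  then have "weighted_sum Z (\<Sum>t<k. 1 - q) (\<Sum>t<k. 1 - of_rat q * a ^ t)"
    by (intro weighted_sum_sum) auto
  also have "(\<Sum>t<k. 1 - of_rat q * a ^ t) = of_nat k"
    using sum_powers_root_of_unity[OF a(3,2)] by (simp add: sum_subtractf sum_distrib_left[symmetric])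
  finally have "weighted_sum Z (1 / of_nat k * (of_nat k * (1 - q))) (of_rat (1 / of_nat k) * of_nat k)"
    by (intro weighted_sum_scale) simp_all
  then have "weighted_sum Z (1 - q) 1" using a(4) by (simp add: of_rat_divide)
  then have le: "1 \<le> C * (1 - q) ^ t" for t
    using C[OF weighted_sum_power[OF Z(2,3), of "1 - q" 1 t]] \<phi>(2) by simp
  have C0: "C > 0" using le[of 0] by simp
  obtain t where "(1 - q) ^ t < inverse C"
    using real_arch_pow_inv[of "of_rat (inverse C) :: real" "of_rat (1 - q) :: real"] C0 q
    by (auto simp: of_rat_power[symmetric] of_rat_less)
  then have "C * (1 - q) ^ t < 1" using C0 by (simp add: field_simps)
  with le[of t] show False by simp
qed

section \<open>Torsion units of twisted group rings\<close>

text \<open>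
  Each nonzero entry allows to split off a rank one idempotent: Wedderburn's rank reduction
  lowers the trace by \<open>1\<close> and clears a column.
\<close>

lemma idempotent_trace:
  fixes e :: "'i \<Rightarrow> 'i \<Rightarrow> 'a::field"
  assumes "finite I" "\<And>i j. i \<in> I \<Longrightarrow> j \<in> I \<Longrightarrow> (\<Sum>k\<in>I. e i k * e k j) = e i j"
  shows "\<exists>r::nat. (\<Sum>i\<in>I. e i i) = of_nat r \<and> (r = 0 \<longrightarrow> (\<forall>i\<in>I. \<forall>j\<in>I. e i j = 0))"
  using assms(2)
proof (induction "card {j\<in>I. \<exists>i\<in>I. e i j \<noteq> 0}" arbitrary: e rule: less_induct)
  case less
  show ?case
  proof (cases "\<forall>i\<in>I. \<forall>j\<in>I. e i j = 0")
    case True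
    then show ?thesis by (intro exI[of _ 0]) simp
  next
    case False
    then obtain a b where ab: "a \<in> I" "b \<in> I" "e a b \<noteq> 0" by blast
    define d where "d i j = e i j - e i b * e a j / e a b" for i j
    have idem: "(\<Sum>k\<in>I. d i k * d k j) = d i j" if "i \<in> I" "j \<in> I" for i j
    proof -
      have "(\<Sum>k\<in>I. d i k * d k j) = (\<Sum>k\<in>I. e i k * e k j) - (\<Sum>k\<in>I. e i k * e k b) * e a j / e a b
          - e i b * (\<Sum>k\<in>I. e a k * e k j) / e a b
          + e i b * (\<Sum>k\<in>I. e a k * e k b) * e a j / (e a b * e a b)"
        unfolding d_def
        by (simp add: algebra_simps sum.distrib sum_subtractf sum_distrib_left sum_distrib_right
            sum_divide_distrib)
      then show ?thesis using that ab by (simp add: less.prems d_def)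
    qed
    \<comment> \<open>A zero column of \<open>e\<close> stays zero in \<open>d\<close>, because the
      correction in column \<open>j\<close> is a multiple of its own entry \<open>e a j\<close>.
      Column \<open>b\<close> becomes zero in addition.\<close>
    have "{j\<in>I. \<exists>i\<in>I. d i j \<noteq> 0} \<subset> {j\<in>I. \<exists>i\<in>I. e i j \<noteq> 0}"
    proof
      show "{j\<in>I. \<exists>i\<in>I. d i j \<noteq> 0} \<subseteq> {j\<in>I. \<exists>i\<in>I. e i j \<noteq> 0}"
      proof
        fix j assume "j \<in> {j\<in>I. \<exists>i\<in>I. d i j \<noteq> 0}"
        then obtain i where i: "j \<in> I" "i \<in> I" "d i j \<noteq> 0" by blast
        then have "e i j \<noteq> 0 \<or> e a j \<noteq> 0" by (auto simp: d_def)
        then show "j \<in> {j\<in>I. \<exists>i\<in>I. e i j \<noteq> 0}" using i ab(1) by blast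
      qed
      have "b \<in> {j\<in>I. \<exists>i\<in>I. e i j \<noteq> 0}" "b \<notin> {j\<in>I. \<exists>i\<in>I. d i j \<noteq> 0}"
        using ab by (auto simp: d_def)
      then show "{j\<in>I. \<exists>i\<in>I. d i j \<noteq> 0} \<noteq> {j\<in>I. \<exists>i\<in>I. e i j \<noteq> 0}" by metis
    qed
    then have "card {j\<in>I. \<exists>i\<in>I. d i j \<noteq> 0} < card {j\<in>I. \<exists>i\<in>I. e i j \<noteq> 0}"
      by (intro psubset_card_mono) (use assms(1) in auto)
    from less.hyps[OF this idem] obtain r where r: "(\<Sum>i\<in>I. d i i) = of_nat r" by blast
    have "(\<Sum>i\<in>I. d i i) = (\<Sum>i\<in>I. e i i) - (\<Sum>i\<in>I. e a i * e i b) / e a b"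
      by (simp add: d_def sum_subtractf sum_divide_distrib mult.commute)
    also have "\<dots> = (\<Sum>i\<in>I. e i i) - 1" using ab by (simp add: less.prems)
    finally have "(\<Sum>i\<in>I. e i i) = of_nat (Suc r)" using r by (simp add: algebra_simps)
    then show ?thesis by blast
  qed
qed

section \<open>Counting and summing roots of unity\<close>

lemma roots_of_unity_finite:
  assumes "k > 0"
  shows "finite {z :: 'a::field. z ^ k = 1}" "card {z :: 'a::field. z ^ k = 1} \<le> k"
proof -
  define p :: "'a poly" where "p = monom 1 k - 1"
  have p: "poly p z = z ^ k - 1" for z by (simp add: p_def poly_monom)
  have "coeff p k = 1" using assms by (simp add: p_def)
  then have nz: "p \<noteq> 0" by auto
  have roots: "{z. z ^ k = 1} = {z. poly p z = 0}" by (simp add: p)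
  show "finite {z :: 'a::field. z ^ k = 1}" unfolding roots by (rule poly_roots_finite[OF nz])
  have "degree p \<le> k" unfolding p_def by (intro degree_diff_le degree_monom_le) simp_all
  then show "card {z :: 'a::field. z ^ k = 1} \<le> k"
    unfolding roots using card_poly_roots_bound[OF nz] by simp
qed

text \<open>\<open>X^k - 1\<close> splits, and a double root would be a root of its derivative
  \<open>k X^(k-1)\<close>. In characteristic 0 that leaves at most 0, which is not a root of
  \<open>X^k - 1\<close>.\<close>

lemma card_roots_of_unity:
  assumes "k > 0"
  shows "card {z :: 'a::{alg_closed_field, field_char_0}. z ^ k = 1} = k"
proof (rule antisym)
  define p :: "'a poly" where "p = monom 1 k - 1"
  have p: "poly p z = z ^ k - 1" for z by (simp add: p_def poly_monom)
  have "coeff p k = 1" using assms by (simp add: p_def)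
  then have nz: "p \<noteq> 0" and ge: "degree p \<ge> k" by (auto intro: le_degree)
  obtain M where M: "size M = degree p" "p = smult (lead_coeff p) (\<Prod>x\<in>#M. [:-x, 1:])"
    using alg_closed_imp_factorization[OF nz] by blast
  have root: "poly p a = 0" if "a \<in># M" for a
    by (subst M(2)) (use that in \<open>auto simp: poly_prod_mset\<close>)
  have "count M a = 1" if "a \<in># M" for a
  proof (rule ccontr)
    assume "count M a \<noteq> 1"
    moreover have "count M a > 0" using that by simp
    ultimately have "count M a \<ge> 2" by linarith
    then have "{#a, a#} \<subseteq># M" by (auto simp: subseteq_mset_def)
    then obtain M' where M': "M = {#a, a#} + M'" by (metis subset_mset.add_diff_inverse)
    define q where "q = smult (lead_coeff p) (\<Prod>x\<in>#M'. [:-x, 1:])"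
    have "p = [:-a, 1:] * ([:-a, 1:] * q)"
      by (subst M(2)) (simp add: M' q_def del: mult_pCons_left mult_pCons_right)
    moreover have "poly (pderiv ([:-a, 1:] * ([:-a, 1:] * q))) a = 0"
      by (simp add: pderiv_mult del: mult_pCons_left mult_pCons_right)
    ultimately have "poly (pderiv p) a = 0" by simp
    moreover have "poly (pderiv p) a = of_nat k * a ^ (k - 1)"
      by (simp add: p_def pderiv_diff pderiv_monom poly_monom)
    ultimately have "a = 0 \<and> k \<noteq> 1" using assms by (cases "k = 1") auto
    then show False using root[OF that] assms by (simp add: p zero_power)
  qed
  then have "size M = card (set_mset M)" by (simp add: size_multiset_overloaded_eq)
  also have "\<dots> \<le> card {z :: 'a. z ^ k = 1}"
    using root p by (intro card_mono roots_of_unity_finite assms) auto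
  finally show "k \<le> card {z :: 'a. z ^ k = 1}" using M(1) ge by simp
qed (rule roots_of_unity_finite[OF assms])

text \<open>For \<open>0 < m < k\<close>, counting yields a \<open>k\<close>-th root of unity
  \<open>y\<close> with \<open>y ^ m \<noteq> 1\<close>. Multiplication by \<open>y\<close> permutes
  the roots but scales the sum by \<open>y ^ m\<close>. The exponent \<open>m = k\<close> is
  included since exponents \<open>k - i\<close> will stand for \<open>-i\<close>.\<close>

lemma sum_roots_of_unity_power:
  assumes "k > 0" "m \<le> k"
  shows "(\<Sum>z | z ^ k = 1. z ^ m) = (if m = 0 \<or> m = k then of_nat k else (0 :: 'a::{alg_closed_field, field_char_0}))"
proof (cases "m = 0 \<or> m = k")
  case True
  then have "(\<Sum>z | z ^ k = 1. z ^ m :: 'a) = (\<Sum>z | z ^ k = (1::'a). 1)" by (intro sum.cong) auto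
  then show ?thesis using True card_roots_of_unity[OF assms(1), where 'a = 'a] by simp
next
  case False
  then have m: "0 < m" "m < k" using assms by auto
  have "\<not> {z :: 'a. z ^ k = 1} \<subseteq> {z. z ^ m = 1}"
    using card_mono[OF roots_of_unity_finite(1)[OF m(1)], of "{z :: 'a. z ^ k = 1}"]
      roots_of_unity_finite(2)[OF m(1), where 'a = 'a] card_roots_of_unity[OF assms(1), where 'a = 'a] m(2)
    by linarith
  then obtain y :: 'a where y: "y ^ k = 1" "y ^ m \<noteq> 1" by blast
  have y0: "y \<noteq> 0" using y(1) assms(1) by (auto simp: power_0_left)
  have "(\<Sum>z | z ^ k = 1. z ^ m) = (\<Sum>z | z ^ k = 1. (y * z) ^ m)"
    by (rule sum.reindex_bij_witness[of _ "\<lambda>z. y * z" "\<lambda>z. z / y"])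
      (use y y0 in \<open>auto simp: power_mult_distrib power_divide\<close>)
  also have "\<dots> = y ^ m * (\<Sum>z | z ^ k = 1. z ^ m)"
    by (simp add: power_mult_distrib sum_distrib_left)
  finally show ?thesis using y(2) False by auto
qed

section \<open>Twisted group rings and their regular representation\<close>

locale twisted =
  fixes H :: "('h, 'c) monoid_scheme" and \<gamma> :: "'h \<Rightarrow> 'h \<Rightarrow> 'k::field" and S :: "'k set"
  assumes H: "group H" "finite (carrier H)" and S: "subring S \<K>" and \<gamma>: "two_cocycle H S \<gamma>"
begin

abbreviation "A \<equiv> twisted_group_ring H S \<gamma>"

sublocale H: group H by (rule H)
sublocale A: ring A by (rule twisted_group_ring_ring[OF H S \<gamma>])

lemma one_eq: "\<one>\<^bsub>A\<^esub> = tg_elem 1 \<one>\<^bsub>H\<^esub>"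
  by (simp add: twisted_group_ring_def)

lemma cocycle: "x \<in> carrier H \<Longrightarrow> y \<in> carrier H \<Longrightarrow> z \<in> carrier H \<Longrightarrow>
    \<gamma> x y * \<gamma> (x \<otimes>\<^bsub>H\<^esub> y) z = \<gamma> y z * \<gamma> x (y \<otimes>\<^bsub>H\<^esub> z)"
  "x \<in> carrier H \<Longrightarrow> \<gamma> \<one>\<^bsub>H\<^esub> x = 1" "x \<in> carrier H \<Longrightarrow> \<gamma> x \<one>\<^bsub>H\<^esub> = 1"
  using \<gamma> by (simp_all add: two_cocycle_def)

lemma inv_cancel: "x \<in> carrier H \<Longrightarrow> y \<in> carrier H \<Longrightarrow> inv\<^bsub>H\<^esub> x \<otimes>\<^bsub>H\<^esub> (x \<otimes>\<^bsub>H\<^esub> y) = y"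
  "x \<in> carrier H \<Longrightarrow> y \<in> carrier H \<Longrightarrow> x \<otimes>\<^bsub>H\<^esub> (inv\<^bsub>H\<^esub> x \<otimes>\<^bsub>H\<^esub> y) = y"
  by (simp_all add: H.m_assoc[symmetric])

lemma mult_eq:
  assumes "x \<in> carrier H"
  shows "(f \<otimes>\<^bsub>A\<^esub> g) x =
    (\<Sum>z\<in>carrier H. f (x \<otimes>\<^bsub>H\<^esub> inv\<^bsub>H\<^esub> z) * g z * \<gamma> (x \<otimes>\<^bsub>H\<^esub> inv\<^bsub>H\<^esub> z) z)"
  unfolding twisted_group_ring_def using assms
  by (auto intro!: sum.reindex_bij_witness[of _ "\<lambda>z. (x \<otimes>\<^bsub>H\<^esub> inv\<^bsub>H\<^esub> z, z)" snd]
      simp: H.m_assoc)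

lemma mult_outside: "x \<notin> carrier H \<Longrightarrow> (f \<otimes>\<^bsub>A\<^esub> g) x = 0"
  unfolding twisted_group_ring_def by (auto intro!: sum.neutral)

text \<open>Linearity over the whole field, so that scalars outside \<open>S\<close> are covered as
  well.\<close>

lemma mult_sum_left:
  "(\<lambda>x. \<Sum>i\<in>I. c i * F i x) \<otimes>\<^bsub>A\<^esub> g = (\<lambda>x. \<Sum>i\<in>I. c i * (F i \<otimes>\<^bsub>A\<^esub> g) x)"
proof
  fix x
  show "((\<lambda>x. \<Sum>i\<in>I. c i * F i x) \<otimes>\<^bsub>A\<^esub> g) x = (\<Sum>i\<in>I. c i * (F i \<otimes>\<^bsub>A\<^esub> g) x)"
  proof (cases "x \<in> carrier H")
    case True
    then show ?thesis
      by (simp add: mult_eq sum_distrib_left sum_distrib_right mult.assoc) (rule sum.swap)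
  qed (simp add: mult_outside)
qed

lemma mult_sum_right:
  "g \<otimes>\<^bsub>A\<^esub> (\<lambda>x. \<Sum>i\<in>I. c i * F i x) = (\<lambda>x. \<Sum>i\<in>I. c i * (g \<otimes>\<^bsub>A\<^esub> F i) x)"
proof
  fix x
  show "(g \<otimes>\<^bsub>A\<^esub> (\<lambda>x. \<Sum>i\<in>I. c i * F i x)) x = (\<Sum>i\<in>I. c i * (g \<otimes>\<^bsub>A\<^esub> F i) x)"
  proof (cases "x \<in> carrier H")
    case True
    then show ?thesis
      by (simp add: mult_eq sum_distrib_left sum_distrib_right mult.assoc mult.left_commute) (rule sum.swap)
  qed (simp add: mult_outside)
qed

lemma tg_elem_mult:
  assumes "x \<in> carrier H" "y \<in> carrier H"
  shows "tg_elem r x \<otimes>\<^bsub>A\<^esub> tg_elem s y = tg_elem (r * s * \<gamma> x y) (x \<otimes>\<^bsub>H\<^esub> y)"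
proof
  fix w
  show "(tg_elem r x \<otimes>\<^bsub>A\<^esub> tg_elem s y) w = tg_elem (r * s * \<gamma> x y) (x \<otimes>\<^bsub>H\<^esub> y) w"
  proof (cases "w \<in> carrier H")
    case True
    have "(tg_elem r x \<otimes>\<^bsub>A\<^esub> tg_elem s y) w =
        (\<Sum>z\<in>carrier H. if z = y then tg_elem r x (w \<otimes>\<^bsub>H\<^esub> inv\<^bsub>H\<^esub> y) * s * \<gamma> (w \<otimes>\<^bsub>H\<^esub> inv\<^bsub>H\<^esub> y) y else 0)"
      unfolding mult_eq[OF True] by (rule sum.cong) (auto simp: tg_elem_def)
    also have "\<dots> = tg_elem r x (w \<otimes>\<^bsub>H\<^esub> inv\<^bsub>H\<^esub> y) * s * \<gamma> (w \<otimes>\<^bsub>H\<^esub> inv\<^bsub>H\<^esub> y) y"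
      using H(2) assms(2) by simp
    also have "\<dots> = tg_elem (r * s * \<gamma> x y) (x \<otimes>\<^bsub>H\<^esub> y) w"
      using assms True by (auto simp: tg_elem_def H.m_assoc)
    finally show ?thesis .
  next
    case False
    then have "w \<noteq> x \<otimes>\<^bsub>H\<^esub> y" using assms by auto
    then show ?thesis using False by (simp add: mult_outside tg_elem_def)
  qed
qed

text \<open>The matrix of left multiplication by \<open>f\<close> in the basis of the
  \<open>u_x\<close>: column \<open>y\<close> holds the coefficients of
  \<open>f u_y\<close>.\<close>

definition regular_matrix :: "('h \<Rightarrow> 'k) \<Rightarrow> 'h \<Rightarrow> 'h \<Rightarrow> 'k"
  where "regular_matrix f x y = f (x \<otimes>\<^bsub>H\<^esub> inv\<^bsub>H\<^esub> y) * \<gamma> (x \<otimes>\<^bsub>H\<^esub> inv\<^bsub>H\<^esub> y) y"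

text \<open>Associativity in coordinates: it comes down to the cocycle identity for
  \<open>x y^-1 w^-1\<close>, \<open>w\<close> and \<open>y\<close>.\<close>

lemma regular_matrix_mult:
  assumes "x \<in> carrier H" "y \<in> carrier H"
  shows "(\<Sum>z\<in>carrier H. regular_matrix f x z * regular_matrix g z y) = regular_matrix (f \<otimes>\<^bsub>A\<^esub> g) x y"
proof -
  have "regular_matrix (f \<otimes>\<^bsub>A\<^esub> g) x y = (\<Sum>w\<in>carrier H.
      f (x \<otimes>\<^bsub>H\<^esub> inv\<^bsub>H\<^esub> y \<otimes>\<^bsub>H\<^esub> inv\<^bsub>H\<^esub> w) * g w * \<gamma> (x \<otimes>\<^bsub>H\<^esub> inv\<^bsub>H\<^esub> y \<otimes>\<^bsub>H\<^esub> inv\<^bsub>H\<^esub> w) w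
        * \<gamma> (x \<otimes>\<^bsub>H\<^esub> inv\<^bsub>H\<^esub> y) y)"
    using assms by (simp add: regular_matrix_def mult_eq sum_distrib_right)
  also have "\<dots> = (\<Sum>z\<in>carrier H. regular_matrix f x z * regular_matrix g z y)"
  proof (rule sum.reindex_bij_witness[of _ "\<lambda>z. z \<otimes>\<^bsub>H\<^esub> inv\<^bsub>H\<^esub> y" "\<lambda>w. w \<otimes>\<^bsub>H\<^esub> y"])
    fix w assume w: "w \<in> carrier H"
    have "\<gamma> (x \<otimes>\<^bsub>H\<^esub> inv\<^bsub>H\<^esub> y \<otimes>\<^bsub>H\<^esub> inv\<^bsub>H\<^esub> w) w * \<gamma> (x \<otimes>\<^bsub>H\<^esub> inv\<^bsub>H\<^esub> y) y =
        \<gamma> w y * \<gamma> (x \<otimes>\<^bsub>H\<^esub> inv\<^bsub>H\<^esub> y \<otimes>\<^bsub>H\<^esub> inv\<^bsub>H\<^esub> w) (w \<otimes>\<^bsub>H\<^esub> y)"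
      using cocycle(1)[of "x \<otimes>\<^bsub>H\<^esub> inv\<^bsub>H\<^esub> y \<otimes>\<^bsub>H\<^esub> inv\<^bsub>H\<^esub> w" w y] assms w by (simp add: H.m_assoc)
    then show "regular_matrix f x (w \<otimes>\<^bsub>H\<^esub> y) * regular_matrix g (w \<otimes>\<^bsub>H\<^esub> y) y =
        f (x \<otimes>\<^bsub>H\<^esub> inv\<^bsub>H\<^esub> y \<otimes>\<^bsub>H\<^esub> inv\<^bsub>H\<^esub> w) * g w * \<gamma> (x \<otimes>\<^bsub>H\<^esub> inv\<^bsub>H\<^esub> y \<otimes>\<^bsub>H\<^esub> inv\<^bsub>H\<^esub> w) w
        * \<gamma> (x \<otimes>\<^bsub>H\<^esub> inv\<^bsub>H\<^esub> y) y"
      using assms w by (simp add: regular_matrix_def H.inv_mult_group H.m_assoc mult_ac)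
  qed (use assms in \<open>auto simp: H.m_assoc\<close>)
  finally show ?thesis by simp
qed

text \<open>By normalization every diagonal entry of the regular matrix is the coefficient at 1, so
  the trace is that coefficient times the group order. The column at 1 is \<open>e\<close> itself,
  hence a zero matrix forces \<open>e\<close> to vanish.\<close>

lemma idempotent_coefficient_one:
  assumes "e \<in> carrier A" "e \<otimes>\<^bsub>A\<^esub> e = e"
  shows "\<exists>r::nat. of_nat (card (carrier H)) * e \<one>\<^bsub>H\<^esub> = of_nat r \<and> (r = 0 \<longrightarrow> e = (\<lambda>_. 0))"
proof -
  obtain r where r: "(\<Sum>x\<in>carrier H. regular_matrix e x x) = of_nat r"
    "r = 0 \<longrightarrow> (\<forall>x\<in>carrier H. \<forall>y\<in>carrier H. regular_matrix e x y = 0)"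
    using idempotent_trace[OF H(2), of "regular_matrix e"] regular_matrix_mult[of _ _ e e] assms(2) by auto
  have "(\<Sum>x\<in>carrier H. regular_matrix e x x) = of_nat (card (carrier H)) * e \<one>\<^bsub>H\<^esub>"
    by (simp add: regular_matrix_def cocycle)
  moreover have "e = (\<lambda>_. 0)" if "r = 0"
  proof
    fix x
    show "e x = 0"
    proof (cases "x \<in> carrier H")
      case True
      then have "regular_matrix e x \<one>\<^bsub>H\<^esub> = 0" using r(2) that by simp
      then show ?thesis using True by (simp add: regular_matrix_def cocycle)
    qed (use assms(1) in \<open>simp add: twisted_group_ring_def\<close>)
  qed
  ultimately show ?thesis using r(1) by (intro exI[of _ r]) auto
qed

end

text \<open>
  Berman--Higman: decompose \<open>f\<close> into eigenprojections \<open>e z\<close> for the \<open>k\<close>-th roots of unity \<open>z\<close>.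
  The coefficient of \<open>e z\<close> at \<open>1\<close> is its rank divided by \<open>\<bar>H\<bar>\<close>, so the coefficient of \<open>f\<close> at \<open>1\<close>
  is a weighted sum of roots of unity; being a root of unity itself, it is the only eigenvalue.
\<close>

lemma torsion_scalar_alg_closed:
  fixes \<gamma> :: "'h \<Rightarrow> 'h \<Rightarrow> 'a::{alg_closed_field, field_char_0}"
  assumes tw: "twisted H \<gamma> UNIV"
    and f: "f \<in> carrier (twisted_group_ring H UNIV \<gamma>)"
      "f [^]\<^bsub>twisted_group_ring H UNIV \<gamma>\<^esub> k = \<one>\<^bsub>twisted_group_ring H UNIV \<gamma>\<^esub>" "k > (0::nat)"
    and f1: "f \<one>\<^bsub>H\<^esub> \<noteq> 0"
    and B: "finite B" "\<And>t. f \<one>\<^bsub>H\<^esub> ^ t \<in> int_module.span B"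
  shows "f = tg_elem (f \<one>\<^bsub>H\<^esub>) \<one>\<^bsub>H\<^esub>"
proof -
  interpret tw: twisted H \<gamma> UNIV by (rule tw)
  let ?A = "twisted_group_ring H UNIV \<gamma>"
  let ?n = "card (carrier H)"
  define Z where "Z = {z :: 'a. z ^ k = 1}"
  have Z: "finite Z" unfolding Z_def by (rule roots_of_unity_finite[OF f(3)])
  define F where "F i = f [^]\<^bsub>?A\<^esub> i" for i :: nat
  have F: "F i \<in> carrier ?A" "F 0 = \<one>\<^bsub>?A\<^esub>" "F k = \<one>\<^bsub>?A\<^esub>" "f \<otimes>\<^bsub>?A\<^esub> F i = F (Suc i)" for i
    using f tw.A.nat_pow_Suc2[OF f(1), of i] by (simp_all add: F_def)
  \<comment> \<open>The Fourier projection onto the eigenvalue \<open>z\<close>; for a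
    \<open>k\<close>-th root of unity, \<open>z ^ (k - i)\<close> is \<open>z^-i\<close>.\<close>
  define e where "e z = (\<lambda>x. \<Sum>i<k. z ^ (k - i) / of_nat k * F i x)" for z
  have out: "g x = 0" if "g \<in> carrier ?A" "x \<notin> carrier H" for g x
    using that by (simp add: twisted_group_ring_def)
  have e: "e z \<in> carrier ?A" for z
    using out[OF F(1)] by (auto simp: e_def twisted_group_ring_def)
  have fe: "f \<otimes>\<^bsub>?A\<^esub> e z = (\<lambda>x. z * e z x)" if "z \<in> Z" for z
  proof
    fix x
    \<comment> \<open>Multiplication by \<open>f\<close> shifts the summation index by one. The
      shift is cyclic: \<open>g 0 = g k\<close> because both \<open>z\<close> and \<open>f\<close>
      have \<open>k\<close>-th power 1.\<close>
    define g where "g i = z ^ (Suc k - i) / of_nat k * F i x" for i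
    have "(f \<otimes>\<^bsub>?A\<^esub> e z) x = (\<Sum>i<k. g (Suc i))"
      unfolding e_def tw.mult_sum_right F(4) by (simp add: g_def)
    also have "\<dots> = (\<Sum>i<k. g i)"
    proof -
      have "g 0 = g k" using that by (simp add: g_def F Z_def)
      then show ?thesis using sum.lessThan_Suc[of g k] sum.lessThan_Suc_shift[of g k] by simp
    qed
    also have "\<dots> = z * e z x"
      unfolding e_def sum_distrib_left
      by (rule sum.cong) (simp_all add: g_def Suc_diff_le)
    finally show "(f \<otimes>\<^bsub>?A\<^esub> e z) x = z * e z x" .
  qed
  have Fe: "F i \<otimes>\<^bsub>?A\<^esub> e z = (\<lambda>x. z ^ i * e z x)" if z: "z \<in> Z" for z i
  proof (induction i)
    case 0
    then show ?case using e[of z] by (simp add: F)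
  next
    case (Suc i)
    have "F (Suc i) \<otimes>\<^bsub>?A\<^esub> e z = f \<otimes>\<^bsub>?A\<^esub> (F i \<otimes>\<^bsub>?A\<^esub> e z)"
      using F(1,4) f(1) e by (metis tw.A.m_assoc)
    also have "\<dots> = f \<otimes>\<^bsub>?A\<^esub> (\<lambda>x. \<Sum>j\<in>{i}. z ^ j * e z x)" by (simp add: Suc)
    also have "\<dots> = (\<lambda>x. z ^ Suc i * e z x)"
      unfolding tw.mult_sum_right fe[OF z] by (simp add: fun_eq_iff)
    finally show ?case .
  qed
  have idem: "e z \<otimes>\<^bsub>?A\<^esub> e z = e z" if z: "z \<in> Z" for z
  proof
    fix x
    have "(e z \<otimes>\<^bsub>?A\<^esub> e z) x = (\<Sum>i<k. z ^ (k - i) / of_nat k * (F i \<otimes>\<^bsub>?A\<^esub> e z) x)"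
      by (subst (1) e_def) (simp only: tw.mult_sum_left)
    also have "\<dots> = (\<Sum>i<k. e z x / of_nat k)"
    proof (rule sum.cong[OF refl])
      fix i assume "i \<in> {..<k}"
      then have "z ^ (k - i) * z ^ i = 1" using z by (simp add: power_add[symmetric] Z_def)
      then show "z ^ (k - i) / of_nat k * (F i \<otimes>\<^bsub>?A\<^esub> e z) x = e z x / of_nat k"
        unfolding Fe[OF z] by (metis (no_types, lifting) mult.assoc mult.commute mult_1 times_divide_eq_left)
    qed
    finally show "(e z \<otimes>\<^bsub>?A\<^esub> e z) x = e z x" using f(3) by simp
  qed
  \<comment> \<open>Orthogonality of roots of unity: only \<open>i = 0\<close>, with exponent
    \<open>k\<close>, survives.\<close>
  have sum_e: "(\<Sum>z\<in>Z. e z x) = \<one>\<^bsub>?A\<^esub> x" for x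
  proof -
    have "(\<Sum>z\<in>Z. e z x) = (\<Sum>i<k. (\<Sum>z\<in>Z. z ^ (k - i)) / of_nat k * F i x)"
      unfolding e_def by (subst sum.swap) (simp add: sum_distrib_right sum_divide_distrib)
    also have "\<dots> = (\<Sum>i<k. if i = 0 then F 0 x else 0)"
      unfolding Z_def by (rule sum.cong) (use f(3) in \<open>auto simp: sum_roots_of_unity_power\<close>)
    finally show ?thesis using f(3) F(2) by simp
  qed
  have sum_ze: "(\<Sum>z\<in>Z. z * e z x) = f x" for x
  proof -
    have "(\<Sum>z\<in>Z. z * e z x) = (\<Sum>z\<in>Z. 1 * (f \<otimes>\<^bsub>?A\<^esub> e z) x)" by (simp add: fe)
    also have "\<dots> = (f \<otimes>\<^bsub>?A\<^esub> (\<lambda>x. \<Sum>z\<in>Z. 1 * e z x)) x" by (simp only: tw.mult_sum_right)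
    also have "(\<lambda>x. \<Sum>z\<in>Z. 1 * e z x) = \<one>\<^bsub>?A\<^esub>" by (simp add: sum_e)
    finally show ?thesis using f(1) by simp
  qed
  have n: "?n > 0" using tw.H(2) tw.H.one_closed by (auto simp: card_gt_0_iff)
  have "\<forall>z\<in>Z. \<exists>r::nat. of_nat ?n * e z \<one>\<^bsub>H\<^esub> = of_nat r \<and> (r = 0 \<longrightarrow> e z = (\<lambda>_. 0))"
    using tw.idempotent_coefficient_one[OF e idem] by blast
  then obtain r :: "'a \<Rightarrow> nat" where r: "\<And>z. z \<in> Z \<Longrightarrow> of_nat ?n * e z \<one>\<^bsub>H\<^esub> = of_nat (r z)"
    "\<And>z. z \<in> Z \<Longrightarrow> r z = 0 \<Longrightarrow> e z = (\<lambda>_. 0)" by metis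
  define w :: "'a \<Rightarrow> rat" where "w z = of_nat (r z) / of_nat ?n" for z
  have w: "of_rat (w z) = e z \<one>\<^bsub>H\<^esub>" if "z \<in> Z" for z
    using r(1)[OF that] n by (simp add: w_def of_rat_divide field_simps)
  have w0: "w z \<ge> 0" for z by (simp add: w_def)
  define l where "l = f \<one>\<^bsub>H\<^esub>"
  have l: "l = (\<Sum>z\<in>Z. of_rat (w z) * z)"
    by (simp add: l_def sum_ze[symmetric] w mult.commute)
  have "of_rat (sum w Z) = (1 :: 'a)"
    by (simp add: of_rat_sum w sum_e tw.one_eq tg_elem_def)
  then have w1: "sum w Z = 1" by (metis of_rat_1 of_rat_eq_iff)
  have "weighted_sum Z (sum w Z) l"
    unfolding l by (intro weighted_sum_sum weighted_sum_single w0)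
  then obtain t where t: "t > 0" "l ^ t = 1"
    using root_of_unity_if_weighted_sum[OF B(1), of "l" Z] B(2) Z w1 f1 f(3)
    by (auto simp: Z_def power_mult_distrib l_def)
  have l0: "l \<noteq> 0" using f1 by (simp add: l_def)
  \<comment> \<open>Dividing by \<open>l\<close> turns the representation of \<open>l\<close> into
    one of 1 by the quotients \<open>z / l\<close>. These are \<open>K\<close>-th roots of unity,
    and such a representation allows no term other than 1.\<close>
  define K where "K = k * t"
  define Y where "Y = {y :: 'a. y ^ K = 1}"
  have K: "K > 0" using f(3) t(1) by (simp add: K_def)
  have zY: "z / l \<in> Y" if "z \<in> Z" for z
  proof -
    have "z ^ K = 1" using that by (simp add: K_def power_mult Z_def)
    moreover have "l ^ K = 1" unfolding K_def using t(2) by (simp add: mult.commute[of k] power_mult)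
    ultimately show ?thesis by (simp add: Y_def power_divide)
  qed
  have zero: "e z = (\<lambda>_. 0)" if z: "z \<in> Z" "z \<noteq> l" for z
  proof -
    have "weighted_sum Y (\<Sum>y\<in>Z - {z}. w y) (\<Sum>y\<in>Z - {z}. of_rat (w y) * (y / l))"
      by (intro weighted_sum_sum weighted_sum_single w0 zY) auto
    moreover have "(\<Sum>y\<in>Z - {z}. w y) = 1 - w z"
      using w1 Z z(1) by (simp add: sum_diff1)
    moreover have "(\<Sum>y\<in>Z - {z}. of_rat (w y) * (y / l)) = 1 - of_rat (w z) * (z / l)"
    proof -
      have "(\<Sum>y\<in>Z. of_rat (w y) * (y / l)) = 1"
        using l l0 by (simp add: sum_divide_distrib[symmetric])
      then show ?thesis using Z z(1) by (simp add: sum_diff1)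
    qed
    ultimately have "weighted_sum Y (1 - w z) (1 - of_rat (w z) * (z / l))" by simp
    then have "w z = 0"
      using zY[OF z(1)] z(2) l0 K w0 roots_of_unity_finite(1)[OF K]
      by (intro weighted_sum_one_extreme[of Y "z / l" K "w z"])
        (auto simp: Y_def power_mult_distrib)
    then show ?thesis using r(2)[OF z(1)] n by (simp add: w_def)
  qed
  have "f x = l * \<one>\<^bsub>?A\<^esub> x" for x
  proof -
    have "(\<Sum>z\<in>Z. z * e z x) = (\<Sum>z\<in>Z. l * e z x)"
      by (rule sum.cong) (auto dest: zero)
    then show ?thesis by (simp add: sum_ze sum_e sum_distrib_left[symmetric])
  qed
  then have "f = tg_elem l \<one>\<^bsub>H\<^esub>" by (auto simp: tw.one_eq tg_elem_def fun_eq_iff)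
  then show ?thesis by (simp add: l_def)
qed

section \<open>Descent from the algebraic closure\<close>

lemma of_int_span_image:
  assumes h: "\<And>x y. h (x + y) = h x + h y" "\<And>(m::int) x. h (of_int m * x) = of_int m * h x" "h 0 = 0"
    and "x \<in> int_module.span B"
  shows "h x \<in> int_module.span (h ` B)"
  using assms(4)
proof (induction rule: int_module.span_induct_alt)
  case base
  then show ?case by (simp add: h int_module.span_zero)
next
  case (step c x y)
  then show ?case
    by (simp add: h int_module.span_add int_module.span_scale int_module.span_base)
qed

text \<open>The eigenprojections need all \<open>k\<close>-th roots of unity, so \<open>f\<close> is
  carried to the algebraic closure. The images of the generators \<open>B\<close> span a lattice
  containing the powers needed there, and injectivity of \<open>to_ac\<close> brings the equation
  back.\<close>

lemma torsion_scalar: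
  fixes \<gamma> :: "'h \<Rightarrow> 'h \<Rightarrow> 'k::field_char_0"
  assumes tw: "twisted H \<gamma> R"
    and f: "f \<in> carrier (twisted_group_ring H R \<gamma>)"
      "f [^]\<^bsub>twisted_group_ring H R \<gamma>\<^esub> k = \<one>\<^bsub>twisted_group_ring H R \<gamma>\<^esub>" "k > (0::nat)"
    and f1: "f \<one>\<^bsub>H\<^esub> \<noteq> 0"
    and B: "finite B" "R = int_module.span B"
  shows "f = tg_elem (f \<one>\<^bsub>H\<^esub>) \<one>\<^bsub>H\<^esub>"
proof -
  interpret tw: twisted H \<gamma> R by (rule tw)
  define \<gamma>' where "\<gamma>' x y = to_ac (\<gamma> x y)" for x y
  have nz: "\<gamma> x y \<noteq> 0" if "x \<in> carrier H" "y \<in> carrier H" for x y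
    using tw.\<gamma> that by (auto simp: two_cocycle_def dest: unit_setD)
  have tw': "twisted H \<gamma>' UNIV"
  proof (rule twisted.intro)
    interpret L: ring "\<K> :: 'k alg_closure ring" by (rule type_field_ring)
    show "subring UNIV (\<K> :: 'k alg_closure ring)" using L.carrier_is_subring by simp
    show "two_cocycle H UNIV \<gamma>'"
      unfolding two_cocycle_def
    proof (intro conjI ballI)
      fix x y assume "x \<in> carrier H" "y \<in> carrier H"
      then show "\<gamma>' x y \<in> unit_set UNIV"
        using nz[of x y] by (intro unit_setI[of _ _ "inverse (\<gamma>' x y)"]) (simp_all add: \<gamma>'_def)
    qed (simp_all add: \<gamma>'_def tw.cocycle flip: to_ac_mult)
  qed (rule tw.H)+
  interpret tw': twisted H \<gamma>' UNIV by (rule tw')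
  let ?A = "twisted_group_ring H R \<gamma>" and ?A' = "twisted_group_ring H UNIV \<gamma>'"
  have mult: "to_ac \<circ> (g \<otimes>\<^bsub>?A\<^esub> h) = (to_ac \<circ> g) \<otimes>\<^bsub>?A'\<^esub> (to_ac \<circ> h)" for g h
  proof
    fix x
    show "(to_ac \<circ> (g \<otimes>\<^bsub>?A\<^esub> h)) x = ((to_ac \<circ> g) \<otimes>\<^bsub>?A'\<^esub> (to_ac \<circ> h)) x"
      by (cases "x \<in> carrier H")
        (simp_all add: tw.mult_eq tw'.mult_eq tw.mult_outside tw'.mult_outside to_ac_sum \<gamma>'_def)
  qed
  have one: "to_ac \<circ> \<one>\<^bsub>?A\<^esub> = \<one>\<^bsub>?A'\<^esub>"
    by (auto simp: tw.one_eq tw'.one_eq tg_elem_def fun_eq_iff)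
  have pow: "to_ac \<circ> (f [^]\<^bsub>?A\<^esub> i) = (to_ac \<circ> f) [^]\<^bsub>?A'\<^esub> i" for i :: nat
  proof (induction i)
    case (Suc i)
    show ?case unfolding tw.A.nat_pow_Suc tw'.A.nat_pow_Suc mult Suc.IH ..
  qed (simp add: one)
  have R: "f \<one>\<^bsub>H\<^esub> ^ t \<in> R" for t
    using f(1) tw.H.one_closed subringD(2,4)[OF tw.S]
    by (induction t) (auto simp: twisted_group_ring_def)
  have eq: "to_ac \<circ> f = tg_elem ((to_ac \<circ> f) \<one>\<^bsub>H\<^esub>) \<one>\<^bsub>H\<^esub>"
  proof (rule torsion_scalar_alg_closed[OF tw' _ _ f(3), of _ "to_ac ` B"])
    show "to_ac \<circ> f \<in> carrier ?A'" using f(1) by (auto simp: twisted_group_ring_def)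
    show "(to_ac \<circ> f) [^]\<^bsub>?A'\<^esub> k = \<one>\<^bsub>?A'\<^esub>" by (simp only: pow[symmetric] f(2) one)
    show "(to_ac \<circ> f) \<one>\<^bsub>H\<^esub> ^ t \<in> int_module.span (to_ac ` B)" for t
      using of_int_span_image[of to_ac "f \<one>\<^bsub>H\<^esub> ^ t" B] R[of t] B(2) by simp
  qed (use f1 B in auto)
  have "to_ac (f x) = to_ac (tg_elem (f \<one>\<^bsub>H\<^esub>) \<one>\<^bsub>H\<^esub> x)" for x
    using fun_cong[OF eq, of x] by (simp add: tg_elem_def split: if_splits)
  then show ?thesis unfolding to_ac_eq_iff by (rule ext)
qed

section \<open>Lifting units\<close>

lemma subfield_inverse:
  assumes "subfield F (\<K> :: 'k::field ring)" "x \<in> F" "x \<noteq> 0"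
  shows "inverse x \<in> F"
proof -
  interpret K: ring "\<K> :: 'k ring" by (rule type_field_ring)
  have "x \<otimes>\<^bsub>\<K>\<^esub> inv\<^bsub>\<K>\<^esub> x = \<one>\<^bsub>\<K>\<^esub>" "inv\<^bsub>\<K>\<^esub> x \<in> F"
    using K.subfield_m_inv[OF assms(1), of x] assms(2,3) by auto
  then show ?thesis by (simp add: inverse_unique)
qed

text \<open>
  An \<open>F\<close>-linear section \<open>d\<close> of the map from formal to actual linear combinations of the \<open>\<chi> n\<close>.
\<close>

lemma linear_section_exists:
  fixes \<chi> :: "'g \<Rightarrow> 'k::field"
  assumes F: "subfield F \<K>" and "finite N"
  shows "\<exists>d. (\<forall>n b. d n b \<in> F) \<and> (\<forall>n\<in>N. \<chi> n = (\<Sum>b\<in>N. d n b * \<chi> b)) \<and>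
    (\<forall>c. c ` N \<subseteq> F \<and> (\<Sum>n\<in>N. c n * \<chi> n) = 0 \<longrightarrow> (\<forall>b\<in>N. (\<Sum>n\<in>N. c n * d n b) = 0))"
  using assms(2)
proof induction
  case empty
  then show ?case using subringD(1)[OF subfieldE(1)[OF F]] by (intro exI[of _ "\<lambda>_ _. 0"]) simp
next
  case (insert a N)
  note S = subfieldE(1)[OF F]
  note S' = subringD[OF S]
  obtain d where d: "\<And>n b. d n b \<in> F" "\<And>n. n \<in> N \<Longrightarrow> \<chi> n = (\<Sum>b\<in>N. d n b * \<chi> b)"
    "\<And>c b. c ` N \<subseteq> F \<Longrightarrow> (\<Sum>n\<in>N. c n * \<chi> n) = 0 \<Longrightarrow> b \<in> N \<Longrightarrow> (\<Sum>n\<in>N. c n * d n b) = 0"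
    using insert.IH by blast
  have ne: "n \<noteq> a" if "n \<in> N" for n using that insert(2) by blast
  show ?case
  \<comment> \<open>The section is already known on the \<open>F\<close>-span of the old values. If
    \<open>\<chi> a\<close> lies in that span, its image is forced; otherwise the formal basis
    vector at \<open>a\<close> is chosen.\<close>
  proof (cases "\<exists>u. u ` N \<subseteq> F \<and> \<chi> a = (\<Sum>n\<in>N. u n * \<chi> n)")
    case True
    then obtain u where u: "u ` N \<subseteq> F" "\<chi> a = (\<Sum>n\<in>N. u n * \<chi> n)" by blast
    define d' where "d' n b = (if b = a then 0 else if n = a then \<Sum>m\<in>N. u m * d m b else d n b)" for n b
    have d'N: "(\<Sum>b\<in>N. d' n b * \<chi> b) = (\<Sum>b\<in>N. d n b * \<chi> b)" if "n \<in> N" for n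
      by (rule sum.cong) (use ne that in \<open>auto simp: d'_def\<close>)
    show ?thesis
    proof (intro exI[of _ d'] conjI allI ballI impI)
      show "d' n b \<in> F" for n b
        using u(1) d(1) by (auto simp: d'_def S' intro!: subring_sum[OF S] S'(4))
      show "\<chi> n = (\<Sum>b\<in>insert a N. d' n b * \<chi> b)" if n: "n \<in> insert a N" for n
      proof (cases "n = a")
        case True
        have "(\<Sum>b\<in>N. d' a b * \<chi> b) = (\<Sum>b\<in>N. (\<Sum>m\<in>N. u m * d m b) * \<chi> b)"
          by (rule sum.cong) (use ne in \<open>auto simp: d'_def\<close>)
        also have "\<dots> = (\<Sum>m\<in>N. u m * (\<Sum>b\<in>N. d m b * \<chi> b))"
          by (subst sum_distrib_right, subst sum.swap) (simp add: sum_distrib_left mult.assoc)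
        also have "\<dots> = \<chi> a" unfolding u(2) by (rule sum.cong) (use d(2) in auto)
        finally show ?thesis using True insert(1,2) by (simp add: d'_def)
      qed (use n insert(1,2) d(2) d'N in \<open>auto simp: d'_def\<close>)
      fix c b assume c: "c ` insert a N \<subseteq> F \<and> (\<Sum>n\<in>insert a N. c n * \<chi> n) = 0" and b: "b \<in> insert a N"
      \<comment> \<open>Substituting the combination \<open>u\<close> for \<open>\<chi> a\<close>
        leaves a relation among the old values.\<close>
      have "(\<Sum>n\<in>N. (c a * u n + c n) * d n b) = 0" if "b \<in> N"
      proof (rule d(3)[OF _ _ that])
        show "(\<lambda>n. c a * u n + c n) ` N \<subseteq> F" using c u(1) by (auto intro!: S'(3,4))
        show "(\<Sum>n\<in>N. (c a * u n + c n) * \<chi> n) = 0"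
          using c insert(1,2) u(2) by (simp add: distrib_right sum.distrib sum_distrib_left mult.assoc)
      qed
      moreover have "(\<Sum>n\<in>insert a N. c n * d' n b) = (\<Sum>n\<in>N. (c a * u n + c n) * d n b)" if "b \<in> N"
      proof -
        have "(\<Sum>n\<in>N. c n * d' n b) = (\<Sum>n\<in>N. c n * d n b)"
          by (rule sum.cong) (use ne that in \<open>auto simp: d'_def\<close>)
        moreover have "d' a b = (\<Sum>m\<in>N. u m * d m b)" using ne[OF that] by (simp add: d'_def)
        ultimately show ?thesis using insert(1,2)
          by (simp add: distrib_right sum.distrib sum_distrib_left mult.assoc)
      qed
      ultimately show "(\<Sum>n\<in>insert a N. c n * d' n b) = 0"
        using b by (auto simp: d'_def)
    qed
  next
    case False
    define d' where "d' n b = (if n = a then if b = a then 1 else 0 else if b = a then 0 else d n b)" for n b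
    show ?thesis
    proof (intro exI[of _ d'] conjI allI ballI impI)
      show "d' n b \<in> F" for n b using d(1) S' by (auto simp: d'_def)
      have d'N: "(\<Sum>b\<in>N. d' n b * \<chi> b) = (if n = a then 0 else \<Sum>b\<in>N. d n b * \<chi> b)" for n
        using ne by (auto simp: d'_def intro!: sum.neutral sum.cong)
      show "\<chi> n = (\<Sum>b\<in>insert a N. d' n b * \<chi> b)" if "n \<in> insert a N" for n
        using that insert(1,2) d(2) ne by (auto simp: d'N) (auto simp: d'_def)
      fix c b assume c: "c ` insert a N \<subseteq> F \<and> (\<Sum>n\<in>insert a N. c n * \<chi> n) = 0" and b: "b \<in> insert a N"
      have c': "c a * \<chi> a + (\<Sum>n\<in>N. c n * \<chi> n) = 0" using c insert(1,2) by simp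
      \<comment> \<open>A relation with \<open>c a \<noteq> 0\<close> could be solved for
        \<open>\<chi> a\<close>, against the case assumption.\<close>
      have ca: "c a = 0"
      proof (rule ccontr)
        assume nz: "c a \<noteq> 0"
        have "(\<lambda>n. - inverse (c a) * c n) ` N \<subseteq> F"
          using c nz by (auto intro!: S'(4,5) subfield_inverse[OF F])
        moreover have "\<chi> a = (\<Sum>n\<in>N. (- inverse (c a) * c n) * \<chi> n)"
        proof -
          have "(\<Sum>n\<in>N. (- inverse (c a) * c n) * \<chi> n) = - inverse (c a) * (\<Sum>n\<in>N. c n * \<chi> n)"
            by (simp add: sum_distrib_left mult.assoc sum_negf)
          also have "(\<Sum>n\<in>N. c n * \<chi> n) = - (c a * \<chi> a)" using c' by (simp add: add_eq_0_iff)
          finally show ?thesis using nz by simp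
        qed
        ultimately show False using False by blast
      qed
      have "(\<Sum>n\<in>N. c n * d' n b) = (if b = a then 0 else \<Sum>n\<in>N. c n * d n b)"
        using ne by (auto simp: d'_def intro!: sum.neutral sum.cong)
      then show "(\<Sum>n\<in>insert a N. c n * d' n b) = 0"
        using ca insert(1,2) b c c' d(3)[of c b] by auto
    qed
  qed
qed

section \<open>Denominators and residues in an order\<close>

lemma denominator_exists:
  fixes R :: "'k::field_char_0 set"
  assumes R: "subring R \<K>" and "finite I" "\<And>i. i \<in> I \<Longrightarrow> f i \<in> rat_space.span R"
  obtains m :: nat where "m > 0" "\<And>i. i \<in> I \<Longrightarrow> of_nat m * f i \<in> R"
proof -
  note R' = subringD[OF R]
  have nat: "of_nat k \<in> R" for k by (induction k) (auto intro: R')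
  have int: "of_int k \<in> R" for k
    by (cases k rule: int_cases2) (auto intro: nat R'(5))
  have one: "\<exists>m>0. of_nat m * x \<in> R" if "x \<in> rat_space.span R" for x
    using that
  proof (induction rule: rat_space.span_induct_alt)
    case base
    then show ?case using R'(1) by (intro exI[of _ 1]) simp
  next
    case (step c x y)
    then obtain m where m: "m > 0" "of_nat m * y \<in> R" by blast
    obtain a b where ab: "c = of_int a / of_int b" "b > 0"
      by (metis quotient_of_denom_pos' quotient_of_div surjective_pairing)
    have "of_nat (nat b * m) * (of_rat c * x + y) = of_nat m * (of_int a * x) + of_nat (nat b) * (of_nat m * y)"
    proof -
      have "of_rat c = (of_int a / of_int b :: 'k)" by (simp add: ab(1) of_rat_divide)
      then show ?thesis using ab(2) by (simp add: field_simps)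
    qed
    also have "\<dots> \<in> R"
      by (intro R'(3)[OF R'(4)[OF nat R'(4)[OF int step(1)]] R'(4)[OF nat m(2)]])
    finally show ?case using m(1) ab(2) by (intro exI[of _ "nat b * m"]) simp
  qed
  have "\<exists>m>0. \<forall>i\<in>I. of_nat m * f i \<in> R"
    using assms(2,3)
  proof induction
    case (insert i I)
    then obtain m where m: "m > 0" "\<forall>j\<in>I. of_nat m * f j \<in> R" by auto
    obtain k where k: "k > 0" "of_nat k * f i \<in> R" using one insert.prems by blast
    have "of_nat (k * m) * f j \<in> R" if j: "j \<in> insert i I" for j
    proof (cases "j = i")
      case True
      have "of_nat m * (of_nat k * f i) \<in> R" by (intro R'(4) nat k)
      then show ?thesis using True by (simp add: mult_ac)
    next
      case False
      then have "of_nat m * f j \<in> R" using j m(2) by blast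
      then have "of_nat k * (of_nat m * f j) \<in> R" by (rule R'(4)[OF nat])
      then show ?thesis by (simp add: mult_ac)
    qed
    then show ?case using m(1) k(1) by (intro exI[of _ "k * m"]) simp
  qed (intro exI[of _ 1], simp)
  then show ?thesis using that by blast
qed

text \<open>Integer coordinates are reduced modulo \<open>m\<close>. \<open>B\<close> is merely a
  generating set, so \<open>T\<close> may hold several representatives of one class.\<close>

lemma finite_residues:
  assumes "finite B" "m > (0::nat)"
  obtains T :: "'k::field_char_0 set" where "finite T" "T \<subseteq> int_module.span B"
    "\<And>x. x \<in> int_module.span B \<Longrightarrow> \<exists>t\<in>T. \<exists>y\<in>int_module.span B. x = t + of_nat m * y"
proof
  let ?s = "\<lambda>u. \<Sum>b\<in>B. of_int (u b) * b"
  let ?T = "?s ` (B \<rightarrow>\<^sub>E {0..<int m})"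
  show "finite ?T" using assms(1) by (intro finite_imageI finite_PiE) auto
  have s: "?s u \<in> int_module.span B" for u
    by (intro int_module.span_sum int_module.span_scale int_module.span_base)
  then show "?T \<subseteq> int_module.span B" by auto
  fix x assume "x \<in> int_module.span B"
  then obtain u where u: "x = ?s u" using int_module.span_finite[OF assms(1)] by auto
  show "\<exists>t\<in>?T. \<exists>y\<in>int_module.span B. x = t + of_nat m * y"
  proof (intro bexI)
    have "of_int (u b) * b = of_int (u b mod int m) * b + of_nat m * (of_int (u b div int m) * b)" for b
    proof -
      have "of_int (u b) = (of_int (u b mod int m + int m * (u b div int m)) :: 'k)" by simp
      then show ?thesis by (simp only: of_int_add of_int_mult of_int_of_nat_eq distrib_right mult.assoc)
    qed
    then show "x = ?s (restrict (\<lambda>b. u b mod int m) B) + of_nat m * ?s (\<lambda>b. u b div int m)"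
      unfolding u by (simp add: sum.distrib sum_distrib_left)
    show "?s (restrict (\<lambda>b. u b mod int m) B) \<in> ?T" using assms(2) by (intro imageI) auto
  qed (rule s)
qed

lemma ring_hom_units:
  assumes A: "ring A" and B: "ring B" and h: "h \<in> Ring.ring_hom A B"
  shows "u \<in> Units A \<Longrightarrow> h u \<in> Units B" "subgroup (h ` Units A) (units_of B)"
proof -
  interpret A: ring A by fact
  interpret B: ring B by fact
  note h' = ring_hom_closed[OF h] ring_hom_mult[OF h] ring_hom_one[OF h]
  show u: "h u \<in> Units B" if "u \<in> Units A" for u
    using that h' unfolding Units_def by (auto, metis)
  interpret U: group_hom "units_of A" "units_of B" h
    by (intro group_hom.intro A.units_group B.units_group group_hom_axioms.intro)
      (auto simp: hom_def units_of_def u h' A.Units_closed)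
  show "subgroup (h ` Units A) (units_of B)"
    using U.img_is_subgroup by (simp add: units_of_def)
qed

text \<open>The arithmetic input in usable form: \<open>B\<^sub>R\<close> provides finitely many
  residues and a lattice for Berman--Higman, and \<open>F_R\<close> provides denominators for
  elements of \<open>F\<close>.\<close>

locale order_setting = psi_setting \<Gamma> G N lam \<mu> R \<beta> \<chi>
  for \<Gamma> :: "('g, 'c) monoid_scheme" and G :: "('h, 'd) monoid_scheme"
    and N :: "'g set" and lam :: "'g \<Rightarrow> 'h" and \<mu> :: "'h \<Rightarrow> 'g"
    and R :: "'k::field_char_0 set" and \<beta> :: "'h \<Rightarrow> 'h \<Rightarrow> 'k" and \<chi> :: "'g \<Rightarrow> 'k" +
  fixes F B\<^sub>R :: "'k set"
  assumes F: "subfield F \<K>" and B\<^sub>R: "finite B\<^sub>R" "R = int_module.span B\<^sub>R"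
    and F_R: "F = rat_space.span R"
begin

sublocale A: twisted \<Gamma> \<beta>\<Gamma> R
  by (intro twisted.intro gr R \<beta>\<Gamma>_cocycle)

sublocale B: twisted G \<beta>G S
  by (intro twisted.intro gr S_subring \<beta>G_cocycle)

lemma N_carrier: "n \<in> N \<Longrightarrow> n \<in> carrier \<Gamma>"
  by (simp add: N_iff)

lemma finite_N: "finite N"
  using gr(2) by (rule rev_finite_subset) (auto simp: N_iff)

text \<open>
  Maschke: averaging a linear section over \<open>N\<close> gives an idempotent that is mapped to \<open>1\<close> by \<open>\<chi>\<close>
  and annihilates the kernel of \<open>F N \<rightarrow> F[\<chi>]\<close>; then clear denominators.
\<close>

lemma kernel_annihilator:
  obtains m :: nat and \<epsilon> where "m > 0" "\<epsilon> ` N \<subseteq> R" "(\<Sum>n\<in>N. \<epsilon> n * \<chi> n) = of_nat m"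
    "\<And>c p. c ` N \<subseteq> R \<Longrightarrow> (\<Sum>n\<in>N. c n * \<chi> n) = 0 \<Longrightarrow> p \<in> N \<Longrightarrow>
      (\<Sum>q\<in>N. \<epsilon> (p \<otimes>\<^bsub>\<Gamma>\<^esub> inv\<^bsub>\<Gamma>\<^esub> q) * c q) = 0"
proof -
  note SF = subfieldE(1)[OF F]
  have RF: "R \<subseteq> F" unfolding F_R by (auto intro: rat_space.span_base)
  obtain d where d: "\<And>n b. d n b \<in> F" "\<And>n. n \<in> N \<Longrightarrow> \<chi> n = (\<Sum>b\<in>N. d n b * \<chi> b)"
    "\<And>c b. c ` N \<subseteq> F \<Longrightarrow> (\<Sum>n\<in>N. c n * \<chi> n) = 0 \<Longrightarrow> b \<in> N \<Longrightarrow> (\<Sum>n\<in>N. c n * d n b) = 0"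
    using linear_section_exists[OF F finite_N, of \<chi>] by blast
  have cN: "of_nat (card N) \<noteq> (0 :: 'k)" using finite_N N_closed(1) by auto
  have natF: "of_nat k \<in> F" for k by (induction k) (auto intro: subringD[OF SF])
  \<comment> \<open>The averaged section at 1: writing \<open>s(\<chi> n)\<close> for the sum of all
    \<open>d n b\<close> times \<open>b\<close>, \<open>a\<close> is the mean over \<open>n\<close>
    of \<open>s(\<chi> n) n^-1\<close>.\<close>
  define a where "a x = inverse (of_nat (card N)) * (\<Sum>n\<in>N. d n (x \<otimes>\<^bsub>\<Gamma>\<^esub> n))" for x
  have aF: "a x \<in> F" for x
    unfolding a_def using cN d(1)
    by (intro subringD(4)[OF SF] subring_sum[OF SF] subfield_inverse[OF F] natF) auto
  have a1: "(\<Sum>x\<in>N. a x * \<chi> x) = 1"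
  proof -
    have inner: "(\<Sum>x\<in>N. d n (x \<otimes>\<^bsub>\<Gamma>\<^esub> n) * \<chi> x) = 1" if n: "n \<in> N" for n
    proof -
      have "(\<Sum>x\<in>N. d n (x \<otimes>\<^bsub>\<Gamma>\<^esub> n) * \<chi> x) = (\<Sum>b\<in>N. d n b * \<chi> (b \<otimes>\<^bsub>\<Gamma>\<^esub> inv\<^bsub>\<Gamma>\<^esub> n))"
        by (rule sum.reindex_bij_witness[of _ "\<lambda>b. b \<otimes>\<^bsub>\<Gamma>\<^esub> inv\<^bsub>\<Gamma>\<^esub> n" "\<lambda>x. x \<otimes>\<^bsub>\<Gamma>\<^esub> n"])
          (use n in \<open>auto simp: N_closed N_carrier \<Gamma>.m_assoc\<close>)
      also have "\<dots> = \<chi> n * \<chi> (inv\<^bsub>\<Gamma>\<^esub> n)"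
        unfolding d(2)[OF n] sum_distrib_right using n
        by (intro sum.cong) (auto simp: \<chi>_mult N_closed)
      also have "\<dots> = 1"
        using n by (simp add: \<chi>_mult[symmetric] N_closed N_carrier \<chi>_one)
      finally show ?thesis .
    qed
    have "(\<Sum>x\<in>N. a x * \<chi> x) = inverse (of_nat (card N)) * (\<Sum>n\<in>N. \<Sum>x\<in>N. d n (x \<otimes>\<^bsub>\<Gamma>\<^esub> n) * \<chi> x)"
      by (subst sum.swap) (simp add: a_def sum_distrib_left sum_distrib_right mult.assoc)
    then show ?thesis using cN by (simp add: inner)
  qed
  \<comment> \<open>The sum is the coefficient at \<open>p\<close> of the product of
    \<open>a\<close> and \<open>c\<close> in the group ring of \<open>N\<close>.\<close>
  have a0: "(\<Sum>q\<in>N. a (p \<otimes>\<^bsub>\<Gamma>\<^esub> inv\<^bsub>\<Gamma>\<^esub> q) * c q) = 0"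
    if c: "c ` N \<subseteq> R" "(\<Sum>n\<in>N. c n * \<chi> n) = 0" and p: "p \<in> N" for c p
  proof -
    have shift: "a (p \<otimes>\<^bsub>\<Gamma>\<^esub> inv\<^bsub>\<Gamma>\<^esub> q) =
        inverse (of_nat (card N)) * (\<Sum>k\<in>N. d (q \<otimes>\<^bsub>\<Gamma>\<^esub> k) (p \<otimes>\<^bsub>\<Gamma>\<^esub> k))" if q: "q \<in> N" for q
    proof -
      have "(\<Sum>n\<in>N. d n (p \<otimes>\<^bsub>\<Gamma>\<^esub> inv\<^bsub>\<Gamma>\<^esub> q \<otimes>\<^bsub>\<Gamma>\<^esub> n)) = (\<Sum>k\<in>N. d (q \<otimes>\<^bsub>\<Gamma>\<^esub> k) (p \<otimes>\<^bsub>\<Gamma>\<^esub> k))"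
        by (rule sum.reindex_bij_witness[of _ "\<lambda>k. q \<otimes>\<^bsub>\<Gamma>\<^esub> k" "\<lambda>n. inv\<^bsub>\<Gamma>\<^esub> q \<otimes>\<^bsub>\<Gamma>\<^esub> n"])
          (use p q in \<open>auto simp: N_closed N_carrier \<Gamma>.m_assoc A.inv_cancel\<close>)
      then show ?thesis by (simp add: a_def)
    qed
    \<comment> \<open>The translate of the relation \<open>c\<close> by \<open>k\<close> is again a
      relation, as its value is only multiplied by \<open>\<chi> k\<close>; so the section kills
      it.\<close>
    have zero: "(\<Sum>q\<in>N. c q * d (q \<otimes>\<^bsub>\<Gamma>\<^esub> k) (p \<otimes>\<^bsub>\<Gamma>\<^esub> k)) = 0" if k: "k \<in> N" for k
    proof -
      have reindex: "(\<Sum>n\<in>N. c (n \<otimes>\<^bsub>\<Gamma>\<^esub> inv\<^bsub>\<Gamma>\<^esub> k) * h n) = (\<Sum>q\<in>N. c q * h (q \<otimes>\<^bsub>\<Gamma>\<^esub> k))" for h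
        by (rule sum.reindex_bij_witness[of _ "\<lambda>q. q \<otimes>\<^bsub>\<Gamma>\<^esub> k" "\<lambda>n. n \<otimes>\<^bsub>\<Gamma>\<^esub> inv\<^bsub>\<Gamma>\<^esub> k"])
          (use k in \<open>auto simp: N_closed N_carrier \<Gamma>.m_assoc\<close>)
      have "(\<Sum>n\<in>N. c (n \<otimes>\<^bsub>\<Gamma>\<^esub> inv\<^bsub>\<Gamma>\<^esub> k) * d n (p \<otimes>\<^bsub>\<Gamma>\<^esub> k)) = 0"
      proof (rule d(3))
        show "(\<lambda>n. c (n \<otimes>\<^bsub>\<Gamma>\<^esub> inv\<^bsub>\<Gamma>\<^esub> k)) ` N \<subseteq> F"
        proof (rule image_subsetI)
          fix n assume "n \<in> N"
          then have "n \<otimes>\<^bsub>\<Gamma>\<^esub> inv\<^bsub>\<Gamma>\<^esub> k \<in> N" using k by (simp add: N_closed)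
          then show "c (n \<otimes>\<^bsub>\<Gamma>\<^esub> inv\<^bsub>\<Gamma>\<^esub> k) \<in> F" using c(1) RF by blast
        qed
        have "(\<Sum>n\<in>N. c (n \<otimes>\<^bsub>\<Gamma>\<^esub> inv\<^bsub>\<Gamma>\<^esub> k) * \<chi> n) = (\<Sum>q\<in>N. c q * \<chi> q) * \<chi> k"
          unfolding reindex sum_distrib_right using k by (intro sum.cong) (auto simp: \<chi>_mult)
        then show "(\<Sum>n\<in>N. c (n \<otimes>\<^bsub>\<Gamma>\<^esub> inv\<^bsub>\<Gamma>\<^esub> k) * \<chi> n) = 0" by (simp add: c(2))
        show "p \<otimes>\<^bsub>\<Gamma>\<^esub> k \<in> N" using p k by (rule N_closed(2))
      qed
      then show ?thesis unfolding reindex .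
    qed
    have "(\<Sum>q\<in>N. a (p \<otimes>\<^bsub>\<Gamma>\<^esub> inv\<^bsub>\<Gamma>\<^esub> q) * c q) = (\<Sum>q\<in>N. \<Sum>k\<in>N.
        inverse (of_nat (card N)) * (c q * d (q \<otimes>\<^bsub>\<Gamma>\<^esub> k) (p \<otimes>\<^bsub>\<Gamma>\<^esub> k)))"
      by (rule sum.cong) (simp_all add: shift sum_distrib_left sum_distrib_right mult_ac)
    also have "\<dots> = (\<Sum>k\<in>N. \<Sum>q\<in>N.
        inverse (of_nat (card N)) * (c q * d (q \<otimes>\<^bsub>\<Gamma>\<^esub> k) (p \<otimes>\<^bsub>\<Gamma>\<^esub> k)))"
      by (rule sum.swap)
    also have "\<dots> = 0" by (simp add: sum_distrib_left[symmetric] zero)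
    finally show ?thesis .
  qed
  obtain m where m: "m > 0" "\<And>n. n \<in> N \<Longrightarrow> of_nat m * a n \<in> R"
    using denominator_exists[OF R finite_N, of a] aF unfolding F_R by blast
  show ?thesis
  proof (rule that[of m "\<lambda>n. of_nat m * a n"])
    show "(\<Sum>n\<in>N. of_nat m * a n * \<chi> n) = of_nat m"
      using a1 by (simp add: mult.assoc sum_distrib_left[symmetric])
    show "(\<Sum>q\<in>N. of_nat m * a (p \<otimes>\<^bsub>\<Gamma>\<^esub> inv\<^bsub>\<Gamma>\<^esub> q) * c q) = 0"
      if "c ` N \<subseteq> R" "(\<Sum>n\<in>N. c n * \<chi> n) = 0" "p \<in> N" for c p
      using a0[OF that] by (simp add: mult.assoc sum_distrib_left[symmetric])
  qed (use m in auto)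
qed

text \<open>As \<open>\<beta>\<close> is inflated and normalized, \<open>R[N]\<close> lies untwisted
  in the ring. An element of the kernel of \<open>\<Psi>\<close> is, on each coset of
  \<open>N\<close>, a linear relation among the \<open>\<chi> n\<close>, so the annihilator from
  \<open>R[N]\<close> works coset by coset.\<close>

lemma annihilator_element:
  obtains m :: nat and e where "m > 0" "e \<in> carrier A" "\<Psi> e = tg_elem (of_nat m) \<one>\<^bsub>G\<^esub>"
    "\<And>f. f \<in> carrier A \<Longrightarrow> \<Psi> f = \<zero>\<^bsub>B\<^esub> \<Longrightarrow> e \<otimes>\<^bsub>A\<^esub> f = \<zero>\<^bsub>A\<^esub>"
proof -
  obtain m :: nat and \<epsilon> where m: "m > 0" "\<epsilon> ` N \<subseteq> R" "(\<Sum>n\<in>N. \<epsilon> n * \<chi> n) = of_nat m"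
    "\<And>c p. c ` N \<subseteq> R \<Longrightarrow> (\<Sum>n\<in>N. c n * \<chi> n) = 0 \<Longrightarrow> p \<in> N \<Longrightarrow>
      (\<Sum>q\<in>N. \<epsilon> (p \<otimes>\<^bsub>\<Gamma>\<^esub> inv\<^bsub>\<Gamma>\<^esub> q) * c q) = 0"
    by (rule kernel_annihilator) (rule that; assumption)
  define e where "e x = (if x \<in> N then \<epsilon> x else 0)" for x
  show ?thesis
  proof (rule that[OF m(1), of e])
    show "e \<in> carrier A"
      using m(2) subringD(1)[OF R] N_carrier by (auto simp: e_def twisted_group_ring_def)
    show "\<Psi> e = tg_elem (of_nat m) \<one>\<^bsub>G\<^esub>"
    proof
      fix g
      consider "g \<notin> carrier G" | "g = \<one>\<^bsub>G\<^esub>" | "g \<in> carrier G" "g \<noteq> \<one>\<^bsub>G\<^esub>" by blast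
      then show "\<Psi> e g = tg_elem (of_nat m) \<one>\<^bsub>G\<^esub> g"
      proof cases
        case 2
        then have "\<Psi> e g = (\<Sum>n\<in>N. \<epsilon> n * \<chi> n)"
          by (auto simp: Psi_def sec(3) e_def N_carrier intro!: sum.cong)
        then show ?thesis using 2 m(3) by (simp add: tg_elem_def)
      next
        case 3
        then have "n \<otimes>\<^bsub>\<Gamma>\<^esub> \<mu> g \<notin> N" if "n \<in> N" for n using that by (auto simp: N_iff)
        then show ?thesis using 3 by (simp add: Psi_def e_def tg_elem_def)
      qed (auto simp: Psi_def tg_elem_def)
    qed
    fix f assume f: "f \<in> carrier A" "\<Psi> f = \<zero>\<^bsub>B\<^esub>"
    have "(e \<otimes>\<^bsub>A\<^esub> f) x = 0" for x
    proof (cases "x \<in> carrier \<Gamma>")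
      case True
      define g p where "g = lam x" and "p = comp x"
      have g: "g \<in> carrier G" and p: "p \<in> N" "x = p \<otimes>\<^bsub>\<Gamma>\<^esub> \<mu> g"
        using True by (simp_all add: g_def p_def comp_N comp_eq)
      have "(e \<otimes>\<^bsub>A\<^esub> f) x = (\<Sum>z\<in>carrier \<Gamma>. if lam z = g then e (x \<otimes>\<^bsub>\<Gamma>\<^esub> inv\<^bsub>\<Gamma>\<^esub> z) * f z else 0)"
      proof -
        have "lam x \<otimes>\<^bsub>G\<^esub> inv\<^bsub>G\<^esub> lam z = \<one>\<^bsub>G\<^esub> \<longleftrightarrow> lam z = lam x" if "z \<in> carrier \<Gamma>" for z
        proof -
          have "\<one>\<^bsub>G\<^esub> = lam x \<otimes>\<^bsub>G\<^esub> inv\<^bsub>G\<^esub> lam z \<longleftrightarrow> lam x = \<one>\<^bsub>G\<^esub> \<otimes>\<^bsub>G\<^esub> lam z"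
            by (rule G.inv_solve_right) (use that True in simp_all)
          moreover have "\<one>\<^bsub>G\<^esub> \<otimes>\<^bsub>G\<^esub> lam z = lam z" using that by simp
          ultimately show ?thesis by metis
        qed
        then show ?thesis
          unfolding A.mult_eq[OF True] using True
          by (intro sum.cong) (auto simp: e_def N_iff \<beta>_one g_def)
      qed
      also have "\<dots> = (\<Sum>z | z \<in> carrier \<Gamma> \<and> lam z = g. e (x \<otimes>\<^bsub>\<Gamma>\<^esub> inv\<^bsub>\<Gamma>\<^esub> z) * f z)"
        using gr(2) by (simp add: sum.inter_filter)
      also have "\<dots> = (\<Sum>q\<in>N. \<epsilon> (p \<otimes>\<^bsub>\<Gamma>\<^esub> inv\<^bsub>\<Gamma>\<^esub> q) * f (q \<otimes>\<^bsub>\<Gamma>\<^esub> \<mu> g))"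
      proof (rule sum.reindex_bij_witness[of _ "\<lambda>q. q \<otimes>\<^bsub>\<Gamma>\<^esub> \<mu> g" comp])
        fix z assume z: "z \<in> {z \<in> carrier \<Gamma>. lam z = g}"
        then have q: "comp z \<in> N" "comp z \<otimes>\<^bsub>\<Gamma>\<^esub> \<mu> g = z" using comp_N comp_eq by auto
        have "x \<otimes>\<^bsub>\<Gamma>\<^esub> inv\<^bsub>\<Gamma>\<^esub> z = p \<otimes>\<^bsub>\<Gamma>\<^esub> \<mu> g \<otimes>\<^bsub>\<Gamma>\<^esub> inv\<^bsub>\<Gamma>\<^esub> (comp z \<otimes>\<^bsub>\<Gamma>\<^esub> \<mu> g)"
          using p q by simp
        also have "\<dots> = p \<otimes>\<^bsub>\<Gamma>\<^esub> inv\<^bsub>\<Gamma>\<^esub> (comp z)"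
          using g p(1) q(1) by (simp add: \<Gamma>.inv_mult_group \<Gamma>.m_assoc A.inv_cancel N_carrier)
        finally show "\<epsilon> (p \<otimes>\<^bsub>\<Gamma>\<^esub> inv\<^bsub>\<Gamma>\<^esub> comp z) * f (comp z \<otimes>\<^bsub>\<Gamma>\<^esub> \<mu> g) = e (x \<otimes>\<^bsub>\<Gamma>\<^esub> inv\<^bsub>\<Gamma>\<^esub> z) * f z"
          using p q by (simp add: e_def N_closed)
      qed (use g in \<open>auto simp: comp_N comp_mu comp_eq N_carrier\<close>, simp add: N_iff)
      also have "\<dots> = 0"
      proof (rule m(4)[OF _ _ p(1)])
        show "(\<lambda>q. f (q \<otimes>\<^bsub>\<Gamma>\<^esub> \<mu> g)) ` N \<subseteq> R"
          using f(1) g by (auto simp: twisted_group_ring_def N_carrier)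
        show "(\<Sum>n\<in>N. f (n \<otimes>\<^bsub>\<Gamma>\<^esub> \<mu> g) * \<chi> n) = 0"
          using fun_cong[OF f(2), of g] g by (simp add: Psi_def twisted_group_ring_def)
      qed
      finally show ?thesis .
    qed (rule A.mult_outside)
    then show "e \<otimes>\<^bsub>A\<^esub> f = \<zero>\<^bsub>A\<^esub>" by (auto simp: twisted_group_ring_def fun_eq_iff)
  qed
qed

section \<open>Units congruent to 1 modulo \<open>m\<close>\<close>

lemma tg_elem_one_mult:
  assumes "c \<in> carrier B"
  shows "tg_elem r \<one>\<^bsub>G\<^esub> \<otimes>\<^bsub>B\<^esub> c = (\<lambda>g. r * c g)" "c \<otimes>\<^bsub>B\<^esub> tg_elem r \<one>\<^bsub>G\<^esub> = (\<lambda>g. r * c g)"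
proof -
  \<comment> \<open>Written as a one-term linear combination of the unit element, so that linearity
    of the product applies.\<close>
  have "tg_elem r \<one>\<^bsub>G\<^esub> = (\<lambda>g. \<Sum>i\<in>{()}. r * \<one>\<^bsub>B\<^esub> g)" by (auto simp: B.one_eq tg_elem_def)
  then show "tg_elem r \<one>\<^bsub>G\<^esub> \<otimes>\<^bsub>B\<^esub> c = (\<lambda>g. r * c g)" "c \<otimes>\<^bsub>B\<^esub> tg_elem r \<one>\<^bsub>G\<^esub> = (\<lambda>g. r * c g)"
    using assms by (simp_all only: B.mult_sum_left B.mult_sum_right) simp_all
qed

lemma congruence_units_lift:
  obtains m :: nat where "m > 0"
    "\<And>b c. b \<in> Units B \<Longrightarrow> c \<in> carrier B \<Longrightarrow> b = \<one>\<^bsub>B\<^esub> \<oplus>\<^bsub>B\<^esub> (\<lambda>g. of_nat m * c g) \<Longrightarrow> b \<in> \<Psi> ` Units A"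
proof -
  obtain m :: nat and e where e: "m > 0" "e \<in> carrier A" "\<Psi> e = tg_elem (of_nat m) \<one>\<^bsub>G\<^esub>"
    "\<And>f. f \<in> carrier A \<Longrightarrow> \<Psi> f = \<zero>\<^bsub>B\<^esub> \<Longrightarrow> e \<otimes>\<^bsub>A\<^esub> f = \<zero>\<^bsub>A\<^esub>"
    by (rule annihilator_element) (rule that; blast)
  define M where "M = \<Psi> e"
  have M: "M \<in> carrier B" unfolding M_def by (rule Psi_closed[OF e(2)])
  have Mc: "M \<otimes>\<^bsub>B\<^esub> c = (\<lambda>g. of_nat m * c g)" "c \<otimes>\<^bsub>B\<^esub> M = M \<otimes>\<^bsub>B\<^esub> c" if "c \<in> carrier B" for c
    unfolding M_def e(3) using tg_elem_one_mult[OF that] by simp_all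
  have M_inj: "c = \<zero>\<^bsub>B\<^esub>" if "c \<in> carrier B" "M \<otimes>\<^bsub>B\<^esub> c = \<zero>\<^bsub>B\<^esub>" for c
    using that(2) e(1) unfolding Mc[OF that(1)] by (simp add: twisted_group_ring_def fun_eq_iff)
  note hom = ring_hom_closed[OF Psi_ring_hom] ring_hom_mult[OF Psi_ring_hom]
    ring_hom_add[OF Psi_ring_hom] ring_hom_one[OF Psi_ring_hom]
  have cancel: "x = \<zero>\<^bsub>B\<^esub>" if "\<one>\<^bsub>B\<^esub> = \<one>\<^bsub>B\<^esub> \<oplus>\<^bsub>B\<^esub> x" for x
    using that by (simp add: twisted_group_ring_def fun_eq_iff)
  have prod: "(\<one>\<^bsub>A\<^esub> \<oplus>\<^bsub>A\<^esub> e \<otimes>\<^bsub>A\<^esub> a) \<otimes>\<^bsub>A\<^esub> (\<one>\<^bsub>A\<^esub> \<oplus>\<^bsub>A\<^esub> e \<otimes>\<^bsub>A\<^esub> a') = \<one>\<^bsub>A\<^esub>"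
    if a: "a \<in> carrier A" "a' \<in> carrier A"
      and one: "(\<one>\<^bsub>B\<^esub> \<oplus>\<^bsub>B\<^esub> M \<otimes>\<^bsub>B\<^esub> \<Psi> a) \<otimes>\<^bsub>B\<^esub> (\<one>\<^bsub>B\<^esub> \<oplus>\<^bsub>B\<^esub> M \<otimes>\<^bsub>B\<^esub> \<Psi> a') = \<one>\<^bsub>B\<^esub>" for a a'
  proof -
    \<comment> \<open>The bracket in \<open>(1 + e a) (1 + e a') = 1 + e t\<close>. Its image under
      \<open>\<Psi>\<close> is killed by \<open>m\<close>, hence zero in characteristic 0.\<close>
    define t where "t = a \<oplus>\<^bsub>A\<^esub> a' \<oplus>\<^bsub>A\<^esub> a \<otimes>\<^bsub>A\<^esub> e \<otimes>\<^bsub>A\<^esub> a'"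
    have t: "t \<in> carrier A" unfolding t_def using a e(2) by simp
    have \<Psi>t: "\<Psi> t = \<Psi> a \<oplus>\<^bsub>B\<^esub> \<Psi> a' \<oplus>\<^bsub>B\<^esub> \<Psi> a \<otimes>\<^bsub>B\<^esub> M \<otimes>\<^bsub>B\<^esub> \<Psi> a'"
      unfolding t_def M_def using a e(2) by (simp add: hom)
    have c: "\<Psi> a \<in> carrier B" "\<Psi> a' \<in> carrier B" using a hom(1) by auto
    have "(\<one>\<^bsub>B\<^esub> \<oplus>\<^bsub>B\<^esub> M \<otimes>\<^bsub>B\<^esub> \<Psi> a) \<otimes>\<^bsub>B\<^esub> (\<one>\<^bsub>B\<^esub> \<oplus>\<^bsub>B\<^esub> M \<otimes>\<^bsub>B\<^esub> \<Psi> a') = \<one>\<^bsub>B\<^esub> \<oplus>\<^bsub>B\<^esub> M \<otimes>\<^bsub>B\<^esub> \<Psi> t"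
      unfolding \<Psi>t using M c
      by (simp add: B.A.l_distr B.A.r_distr B.A.m_assoc B.A.a_ac)
    then have "\<one>\<^bsub>B\<^esub> = \<one>\<^bsub>B\<^esub> \<oplus>\<^bsub>B\<^esub> M \<otimes>\<^bsub>B\<^esub> \<Psi> t" unfolding one .
    then have "M \<otimes>\<^bsub>B\<^esub> \<Psi> t = \<zero>\<^bsub>B\<^esub>" by (rule cancel)
    then have "e \<otimes>\<^bsub>A\<^esub> t = \<zero>\<^bsub>A\<^esub>" using M_inj e(4) t hom(1) by blast
    moreover have "(\<one>\<^bsub>A\<^esub> \<oplus>\<^bsub>A\<^esub> e \<otimes>\<^bsub>A\<^esub> a) \<otimes>\<^bsub>A\<^esub> (\<one>\<^bsub>A\<^esub> \<oplus>\<^bsub>A\<^esub> e \<otimes>\<^bsub>A\<^esub> a') = \<one>\<^bsub>A\<^esub> \<oplus>\<^bsub>A\<^esub> e \<otimes>\<^bsub>A\<^esub> t"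
      unfolding t_def using a e(2)
      by (simp add: A.A.l_distr A.A.r_distr A.A.m_assoc A.A.a_ac)
    ultimately show ?thesis by simp
  qed
  show ?thesis
  proof (rule that[OF e(1)])
    fix b c assume b: "b \<in> Units B" and c: "c \<in> carrier B"
      and bc: "b = \<one>\<^bsub>B\<^esub> \<oplus>\<^bsub>B\<^esub> (\<lambda>g. of_nat m * c g)"
    have bc: "b = \<one>\<^bsub>B\<^esub> \<oplus>\<^bsub>B\<^esub> M \<otimes>\<^bsub>B\<^esub> c" using bc Mc(1)[OF c] by simp
    define b' where "b' = inv\<^bsub>B\<^esub> b"
    have b': "b \<in> carrier B" "b' \<in> carrier B" "b \<otimes>\<^bsub>B\<^esub> b' = \<one>\<^bsub>B\<^esub>" "b' \<otimes>\<^bsub>B\<^esub> b = \<one>\<^bsub>B\<^esub>"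
      using b by (simp_all add: b'_def B.A.Units_closed)
    \<comment> \<open>From \<open>1 = b b' = b' + m c b'\<close>: the inverse of \<open>b\<close> is
      itself congruent to 1 modulo \<open>m\<close>, with \<open>c' = - c b'\<close>.\<close>
    define c' where "c' = \<ominus>\<^bsub>B\<^esub> (c \<otimes>\<^bsub>B\<^esub> b')"
    have c': "c' \<in> carrier B" using c b' by (simp add: c'_def)
    define x where "x = M \<otimes>\<^bsub>B\<^esub> (c \<otimes>\<^bsub>B\<^esub> b')"
    have x: "x \<in> carrier B" using M c b'(2) by (simp add: x_def)
    have "b \<otimes>\<^bsub>B\<^esub> b' = b' \<oplus>\<^bsub>B\<^esub> x"
      unfolding x_def using b'(2) c M by (subst bc) (simp add: B.A.l_distr B.A.m_assoc)
    then have one: "b' \<oplus>\<^bsub>B\<^esub> x = \<one>\<^bsub>B\<^esub>" unfolding b'(3) by (rule sym)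
    have "M \<otimes>\<^bsub>B\<^esub> c' = \<ominus>\<^bsub>B\<^esub> x"
      unfolding c'_def x_def using M c b'(2) by (simp add: B.A.r_minus)
    then have "\<one>\<^bsub>B\<^esub> \<oplus>\<^bsub>B\<^esub> M \<otimes>\<^bsub>B\<^esub> c' = (b' \<oplus>\<^bsub>B\<^esub> x) \<oplus>\<^bsub>B\<^esub> \<ominus>\<^bsub>B\<^esub> x"
      by (simp only: one)
    then have bc': "b' = \<one>\<^bsub>B\<^esub> \<oplus>\<^bsub>B\<^esub> M \<otimes>\<^bsub>B\<^esub> c'"
      using x b'(2) by (simp add: B.A.a_assoc B.A.r_neg)
    have "c \<in> \<Psi> ` carrier A" "c' \<in> \<Psi> ` carrier A" unfolding Psi_surj by (rule c c')+
    then obtain a a' where a: "a \<in> carrier A" "\<Psi> a = c" "a' \<in> carrier A" "\<Psi> a' = c'" by blast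
    let ?u = "\<one>\<^bsub>A\<^esub> \<oplus>\<^bsub>A\<^esub> e \<otimes>\<^bsub>A\<^esub> a" and ?u' = "\<one>\<^bsub>A\<^esub> \<oplus>\<^bsub>A\<^esub> e \<otimes>\<^bsub>A\<^esub> a'"
    have "?u \<otimes>\<^bsub>A\<^esub> ?u' = \<one>\<^bsub>A\<^esub>"
      by (rule prod[OF a(1,3)]) (unfold a bc[symmetric] bc'[symmetric], rule b')
    moreover have "?u' \<otimes>\<^bsub>A\<^esub> ?u = \<one>\<^bsub>A\<^esub>"
      by (rule prod[OF a(3,1)]) (unfold a bc[symmetric] bc'[symmetric], rule b')
    moreover have "?u \<in> carrier A" "?u' \<in> carrier A" using a e(2) by simp_all
    ultimately have "?u \<in> Units A" unfolding Units_def by blast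
    moreover have "\<Psi> ?u = b" unfolding bc M_def using a(1) e(2) by (simp add: hom a(2))
    ultimately show "b \<in> \<Psi> ` Units A" by blast
  qed
qed

section \<open>Finiteness of the cokernel\<close>

lemma S_residues:
  assumes "m > (0::nat)"
  obtains T where "finite T" "\<And>s. s \<in> S \<Longrightarrow> \<exists>t\<in>T. \<exists>y\<in>S. s = t + of_nat m * y"
proof -
  obtain T where T: "finite T" "T \<subseteq> R" "\<And>x. x \<in> R \<Longrightarrow> \<exists>t\<in>T. \<exists>y\<in>R. x = t + of_nat m * y"
    using finite_residues[OF B\<^sub>R(1) assms] unfolding B\<^sub>R(2)[symmetric] by metis
  then obtain t y where ty: "\<And>x. x \<in> R \<Longrightarrow> t x \<in> T \<and> y x \<in> R \<and> x = t x + of_nat m * y x" by metis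
  let ?T = "(\<lambda>c. \<Sum>n\<in>N. c n * \<chi> n) ` (N \<rightarrow>\<^sub>E T)"
  show ?thesis
  proof (rule that)
    show "finite ?T" using finite_N T(1) by (intro finite_imageI finite_PiE) auto
    fix s assume "s \<in> S"
    then obtain c where c: "c ` N \<subseteq> R" "s = (\<Sum>n\<in>N. c n * \<chi> n)" using S_span by blast
    show "\<exists>t\<in>?T. \<exists>y\<in>S. s = t + of_nat m * y"
    proof (intro bexI)
      have "c n = t (c n) + of_nat m * y (c n)" if "n \<in> N" for n using ty c(1) that by blast
      then have "s = (\<Sum>n\<in>N. (t (c n) + of_nat m * y (c n)) * \<chi> n)"
        unfolding c(2) by (intro sum.cong) simp_all
      then show "s = (\<Sum>n\<in>N. restrict (\<lambda>n. t (c n)) N n * \<chi> n) + of_nat m * (\<Sum>n\<in>N. y (c n) * \<chi> n)"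
        by (simp add: distrib_right sum.distrib sum_distrib_left mult.assoc)
      show "(\<Sum>n\<in>N. restrict (\<lambda>n. t (c n)) N n * \<chi> n) \<in> ?T"
        using ty c(1) by (intro imageI) auto
      show "(\<Sum>n\<in>N. y (c n) * \<chi> n) \<in> S"
        using ty c(1) by (intro subring_sum[OF S_subring] subringD(4)[OF S_subring] R_S \<chi>_S) auto
    qed
  qed
qed

text \<open>If \<open>b = b' + m w\<close>, then \<open>b b'^-1 = 1 + m w b'^-1\<close> lifts to a
  unit, so \<open>b\<close> and \<open>b'\<close> share a right coset. Residues are compared
  coefficient by coefficient over the finite group \<open>G\<close>.\<close>

lemma finite_cokernel: "finite (rcosets\<^bsub>units_of B\<^esub> (\<Psi> ` Units A))"
proof -
  let ?U = "units_of B" and ?H = "\<Psi> ` Units A"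
  interpret U: group ?U by (rule B.A.units_group)
  have H: "subgroup ?H ?U" by (rule ring_hom_units(2)[OF A.A.ring_axioms B.A.ring_axioms Psi_ring_hom])
  obtain m :: nat where m: "m > 0"
    "\<And>b c. b \<in> Units B \<Longrightarrow> c \<in> carrier B \<Longrightarrow> b = \<one>\<^bsub>B\<^esub> \<oplus>\<^bsub>B\<^esub> (\<lambda>g. of_nat m * c g) \<Longrightarrow> b \<in> ?H"
    by (rule congruence_units_lift) (rule that; blast)
  obtain T where T: "finite T" "\<And>s. s \<in> S \<Longrightarrow> \<exists>t\<in>T. \<exists>y\<in>S. s = t + of_nat m * y"
    by (rule S_residues[OF m(1)]) (rule that; blast)
  then obtain t y where ty: "\<And>s. s \<in> S \<Longrightarrow> t s \<in> T \<and> y s \<in> S \<and> s = t s + of_nat m * y s" by metis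
  define \<tau> where "\<tau> b = restrict (\<lambda>g. t (b g)) (carrier G)" for b
  have coeff: "b g \<in> S" if "b \<in> carrier B" "g \<in> carrier G" for b g
    using that by (simp add: twisted_group_ring_def)
  have "\<tau> ` Units B \<subseteq> carrier G \<rightarrow>\<^sub>E T"
    using ty coeff B.A.Units_closed by (auto simp: \<tau>_def)
  then have fin: "finite (\<tau> ` Units B)"
    by (rule finite_subset) (use gr(4) T(1) in \<open>auto intro: finite_PiE\<close>)
  have same: "?H #>\<^bsub>?U\<^esub> b = ?H #>\<^bsub>?U\<^esub> b'" if b: "b \<in> Units B" "b' \<in> Units B" "\<tau> b = \<tau> b'" for b b'
  proof -
    \<comment> \<open>The quotient of \<open>b - b'\<close> by \<open>m\<close>; the value 0 outside
      \<open>G\<close> keeps it in the carrier.\<close>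
    define w where "w g = (if g \<in> carrier G then y (b g) - y (b' g) else 0)" for g
    have bc: "b \<in> carrier B" "b' \<in> carrier B" using b by (auto intro: B.A.Units_closed)
    have wB: "w \<in> carrier B"
      using ty coeff[OF bc(1)] coeff[OF bc(2)] subringD(3,5)[OF S_subring]
      by (auto simp: w_def twisted_group_ring_def diff_conv_add_uminus simp del: add_uminus_conv_diff)
    have diff: "b = b' \<oplus>\<^bsub>B\<^esub> (\<lambda>g. of_nat m * w g)"
    proof
      fix g
      show "b g = (b' \<oplus>\<^bsub>B\<^esub> (\<lambda>g. of_nat m * w g)) g"
      proof (cases "g \<in> carrier G")
        case True
        have *: "p = p' + of_nat m * (u - v)" if "p = q + of_nat m * u" "p' = q' + of_nat m * v" "q = q'"
          for p p' q q' u v :: 'k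
          using that by (simp add: algebra_simps)
        have "t (b g) = t (b' g)" using fun_cong[OF b(3), of g] True by (simp add: \<tau>_def)
        then have "b g = b' g + of_nat m * (y (b g) - y (b' g))"
          using ty coeff[OF bc(1) True] coeff[OF bc(2) True] by (intro *) blast+
        then show ?thesis using True by (simp add: twisted_group_ring_def w_def)
      qed (use bc in \<open>simp add: twisted_group_ring_def w_def\<close>)
    qed
    have wi: "w \<otimes>\<^bsub>B\<^esub> inv\<^bsub>B\<^esub> b' \<in> carrier B" using wB b(2) by simp
    have mS: "tg_elem (of_nat m) \<one>\<^bsub>G\<^esub> \<in> carrier B"
    proof (rule tg_elem_closed[OF S_subring])
      show "of_nat m \<in> S" by (induction m) (auto intro: subringD[OF S_subring])
    qed simp
    have "b \<otimes>\<^bsub>B\<^esub> inv\<^bsub>B\<^esub> b' = (b' \<oplus>\<^bsub>B\<^esub> tg_elem (of_nat m) \<one>\<^bsub>G\<^esub> \<otimes>\<^bsub>B\<^esub> w) \<otimes>\<^bsub>B\<^esub> inv\<^bsub>B\<^esub> b'"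
      by (subst diff) (simp add: tg_elem_one_mult[OF wB])
    also have "\<dots> = \<one>\<^bsub>B\<^esub> \<oplus>\<^bsub>B\<^esub> tg_elem (of_nat m) \<one>\<^bsub>G\<^esub> \<otimes>\<^bsub>B\<^esub> (w \<otimes>\<^bsub>B\<^esub> inv\<^bsub>B\<^esub> b')"
    proof -
      have i: "inv\<^bsub>B\<^esub> b' \<in> carrier B" using b(2) by simp
      show ?thesis using b(2) by (simp only: B.A.l_distr B.A.m_assoc B.A.m_closed bc wB mS i B.A.Units_r_inv)
    qed
    finally have "b \<otimes>\<^bsub>B\<^esub> inv\<^bsub>B\<^esub> b' = \<one>\<^bsub>B\<^esub> \<oplus>\<^bsub>B\<^esub> (\<lambda>g. of_nat m * (w \<otimes>\<^bsub>B\<^esub> inv\<^bsub>B\<^esub> b') g)"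
      by (simp add: tg_elem_one_mult[OF wi])
    moreover have "b \<otimes>\<^bsub>B\<^esub> inv\<^bsub>B\<^esub> b' \<in> Units B" using b(1,2) by simp
    ultimately have "b \<otimes>\<^bsub>B\<^esub> inv\<^bsub>B\<^esub> b' \<in> ?H" by (intro m(2)[OF _ wi])
    moreover have "b = (b \<otimes>\<^bsub>B\<^esub> inv\<^bsub>B\<^esub> b') \<otimes>\<^bsub>B\<^esub> b'" using b bc by (simp add: B.A.m_assoc)
    ultimately have "b \<in> ?H #>\<^bsub>?U\<^esub> b'"
      unfolding r_coset_def units_of_mult by blast
    moreover have "b' \<in> carrier ?U" using b(2) by (simp add: units_of_carrier)
    ultimately show ?thesis by (rule U.repr_independence[OF _ _ H, symmetric])
  qed
  \<comment> \<open>Each coset is recovered from the residues of any of its members, through a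
    chosen unit with the same residues.\<close>
  have "rcosets\<^bsub>?U\<^esub> ?H \<subseteq> (\<lambda>s. ?H #>\<^bsub>?U\<^esub> inv_into (Units B) \<tau> s) ` \<tau> ` Units B"
  proof
    fix C assume "C \<in> rcosets\<^bsub>?U\<^esub> ?H"
    then obtain b where b: "b \<in> Units B" "C = ?H #>\<^bsub>?U\<^esub> b" by (auto simp: RCOSETS_def units_of_def)
    have "C = ?H #>\<^bsub>?U\<^esub> inv_into (Units B) \<tau> (\<tau> b)"
      unfolding b(2) by (rule same) (simp_all add: b(1) inv_into_into f_inv_into_f)
    then show "C \<in> (\<lambda>s. ?H #>\<^bsub>?U\<^esub> inv_into (Units B) \<tau> s) ` \<tau> ` Units B" using b(1) by blast
  qed
  then show ?thesis using finite_subset fin by blast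
qed

end

section \<open>Torsion units in the kernel\<close>

context order_setting
begin

lemma \<chi>_pow: "n \<in> N \<Longrightarrow> n [^]\<^bsub>\<Gamma>\<^esub> k \<in> N \<and> \<chi> (n [^]\<^bsub>\<Gamma>\<^esub> k) = \<chi> n ^ k" for k :: nat
  by (induction k) (auto simp: N_closed \<chi>_mult \<chi>_one)

text \<open>The inflated cocycle is 1 on \<open>N\<close>, so the \<open>u_a\<close> with
  \<open>a\<close> in \<open>N\<close> multiply as in the group.\<close>

lemma tg_elem_pow:
  "a \<in> N \<Longrightarrow> tg_elem r a [^]\<^bsub>A\<^esub> k = tg_elem (r ^ k) (a [^]\<^bsub>\<Gamma>\<^esub> k)" for k :: nat
proof (induction k)
  case (Suc k)
  then show ?case
    using A.tg_elem_mult[of "a [^]\<^bsub>\<Gamma>\<^esub> k" a] \<chi>_pow[of a k]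
    by (simp add: N_carrier \<beta>_one N_iff mult.commute)
qed (simp add: A.one_eq)

lemma order_pos: "card (carrier \<Gamma>) > 0"
  using gr(2) \<Gamma>.one_closed by (auto simp: card_gt_0_iff)

lemma pow_order: "a \<in> carrier \<Gamma> \<Longrightarrow> a [^]\<^bsub>\<Gamma>\<^esub> card (carrier \<Gamma>) = \<one>\<^bsub>\<Gamma>\<^esub>"
  using \<Gamma>.pow_order_eq_1 by (simp add: Coset.order_def)

lemma tg_elem_torsion:
  assumes "a \<in> N" "r \<in> R" "r ^ card (carrier \<Gamma>) = 1"
  shows "tg_elem r a [^]\<^bsub>A\<^esub> card (carrier \<Gamma>) = \<one>\<^bsub>A\<^esub>"
  using assms by (simp add: tg_elem_pow pow_order N_carrier A.one_eq)

lemma Psi_tg_elem_N: "a \<in> N \<Longrightarrow> r \<in> R \<Longrightarrow> \<Psi> (tg_elem r a) = tg_elem (r * \<chi> a) \<one>\<^bsub>G\<^esub>"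
  using Psi_tg_elem[of r a "\<one>\<^bsub>G\<^esub>"] by (simp add: sec(3) N_carrier)

text \<open>The listed elements are torsion because the order of \<open>\<Gamma>\<close> kills both
  \<open>a\<close> and \<open>\<chi> a\<close>. Conversely, Berman--Higman applies once a nonzero
  coefficient on \<open>N\<close> has been moved to 1.\<close>

lemma torsion_kernel:
  assumes central: "\<forall>n\<in>N. \<forall>x\<in>carrier \<Gamma>. n \<otimes>\<^bsub>\<Gamma>\<^esub> x = x \<otimes>\<^bsub>\<Gamma>\<^esub> n" and \<chi>R: "\<chi> ` N \<subseteq> unit_set R"
  shows "torsion_units A \<inter> kernel (units_of A) (units_of B) \<Psi> = {tg_elem (inverse (\<chi> a)) a | a. a \<in> N}"
proof (intro equalityI subsetI)
  let ?n = "card (carrier \<Gamma>)"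
  fix v assume "v \<in> {tg_elem (inverse (\<chi> a)) a | a. a \<in> N}"
  then obtain a where a: "a \<in> N" "v = tg_elem (inverse (\<chi> a)) a" by blast
  have "\<chi> (inv\<^bsub>\<Gamma>\<^esub> a) * \<chi> a = 1" using a(1) by (simp add: \<chi>_mult[symmetric] N_closed N_carrier \<chi>_one)
  then have "inverse (\<chi> a) = \<chi> (inv\<^bsub>\<Gamma>\<^esub> a)" using \<chi>_nz[OF a(1)] by (simp add: field_simps)
  moreover have "\<chi> (inv\<^bsub>\<Gamma>\<^esub> a) \<in> unit_set R" using \<chi>R N_closed(3)[OF a(1)] by blast
  ultimately have r: "inverse (\<chi> a) \<in> R" by (simp add: unit_setD(1))
  have v: "v \<in> carrier A" unfolding a(2) by (rule tg_elem_closed[OF R r N_carrier[OF a(1)]])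
  have "\<chi> a ^ ?n = 1" using \<chi>_pow[OF a(1), of ?n] by (simp add: pow_order N_carrier a \<chi>_one)
  then have pow: "v [^]\<^bsub>A\<^esub> ?n = \<one>\<^bsub>A\<^esub>"
    unfolding a(2) by (intro tg_elem_torsion a r) (simp add: power_inverse)
  \<comment> \<open>The inverse of \<open>v\<close> is its power with exponent one less than the
    group order.\<close>
  obtain k where k: "?n = Suc k" using order_pos gr0_implies_Suc by blast
  have "v \<otimes>\<^bsub>A\<^esub> v [^]\<^bsub>A\<^esub> k = \<one>\<^bsub>A\<^esub>" "v [^]\<^bsub>A\<^esub> k \<otimes>\<^bsub>A\<^esub> v = \<one>\<^bsub>A\<^esub>"
    using pow v A.A.nat_pow_Suc2[of v k] by (simp_all add: k)
  then have "v \<in> Units A" using v unfolding Units_def by blast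
  moreover have "\<Psi> v = \<one>\<^bsub>B\<^esub>" using \<chi>_nz[OF a(1)] by (simp add: a Psi_tg_elem_N r B.one_eq)
  ultimately show "v \<in> torsion_units A \<inter> kernel (units_of A) (units_of B) \<Psi>"
    using pow order_pos by (auto simp: torsion_units_def kernel_def units_of_def)
next
  let ?n = "card (carrier \<Gamma>)"
  fix u assume "u \<in> torsion_units A \<inter> kernel (units_of A) (units_of B) \<Psi>"
  then obtain k :: nat where u: "u \<in> carrier A" "\<Psi> u = \<one>\<^bsub>B\<^esub>" and k: "k > 0" "u [^]\<^bsub>A\<^esub> k = \<one>\<^bsub>A\<^esub>"
    by (auto simp: torsion_units_def kernel_def units_of_def Units_def)
  \<comment> \<open>The coefficient of \<open>\<Psi> u\<close> at 1 involves only coefficients of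
    \<open>u\<close> on \<open>N\<close>, so one of these must be nonzero.\<close>
  have "(\<Sum>n\<in>N. u (n \<otimes>\<^bsub>\<Gamma>\<^esub> \<mu> \<one>\<^bsub>G\<^esub>) * \<chi> n) = 1"
    using fun_cong[OF u(2), of "\<one>\<^bsub>G\<^esub>"] by (simp add: Psi_def B.one_eq tg_elem_def)
  then obtain a where a: "a \<in> N" "u a \<noteq> 0"
    by (metis (no_types, lifting) N_carrier \<Gamma>.r_one mult_zero_left sec(3) sum.neutral zero_neq_one)
  note ac = N_carrier[OF a(1)]
  define v where "v = tg_elem (1 :: 'k) (inv\<^bsub>\<Gamma>\<^esub> a)"
  have one_R: "1 \<in> R" by (rule subringD(2)[OF R])
  have v: "v \<in> carrier A" unfolding v_def using ac by (intro tg_elem_closed R one_R) simp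
  have vn: "v [^]\<^bsub>A\<^esub> ?n = \<one>\<^bsub>A\<^esub>"
    unfolding v_def by (rule tg_elem_torsion) (use a one_R in \<open>auto simp: N_closed\<close>)
  \<comment> \<open>Multiplication by \<open>v\<close> on either side translates coefficients by
    \<open>a\<close>; on the left this uses that \<open>a\<close> is central.\<close>
  have uv: "(u \<otimes>\<^bsub>A\<^esub> v) x = u (x \<otimes>\<^bsub>\<Gamma>\<^esub> a)" and vu: "(v \<otimes>\<^bsub>A\<^esub> u) x = u (x \<otimes>\<^bsub>\<Gamma>\<^esub> a)" if x: "x \<in> carrier \<Gamma>" for x
  proof -
    have "(u \<otimes>\<^bsub>A\<^esub> v) x = (\<Sum>z\<in>carrier \<Gamma>. if z = inv\<^bsub>\<Gamma>\<^esub> a then u (x \<otimes>\<^bsub>\<Gamma>\<^esub> a) else 0)"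
      unfolding A.mult_eq[OF x] using a(1) ac x
      by (intro sum.cong) (auto simp: v_def tg_elem_def N_iff \<beta>_one)
    then show "(u \<otimes>\<^bsub>A\<^esub> v) x = u (x \<otimes>\<^bsub>\<Gamma>\<^esub> a)" using gr(2) ac by simp
    have "x \<otimes>\<^bsub>\<Gamma>\<^esub> inv\<^bsub>\<Gamma>\<^esub> z = inv\<^bsub>\<Gamma>\<^esub> a \<longleftrightarrow> z = x \<otimes>\<^bsub>\<Gamma>\<^esub> a" if z: "z \<in> carrier \<Gamma>" for z
    proof -
      have "x \<otimes>\<^bsub>\<Gamma>\<^esub> inv\<^bsub>\<Gamma>\<^esub> z = inv\<^bsub>\<Gamma>\<^esub> a \<longleftrightarrow> x = inv\<^bsub>\<Gamma>\<^esub> a \<otimes>\<^bsub>\<Gamma>\<^esub> z"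
        using x z ac by (metis \<Gamma>.inv_closed \<Gamma>.inv_solve_right)
      also have "\<dots> \<longleftrightarrow> z = a \<otimes>\<^bsub>\<Gamma>\<^esub> x" using x z ac by (metis \<Gamma>.inv_solve_left)
      also have "a \<otimes>\<^bsub>\<Gamma>\<^esub> x = x \<otimes>\<^bsub>\<Gamma>\<^esub> a" using central a(1) x by blast
      finally show ?thesis .
    qed
    then have "(v \<otimes>\<^bsub>A\<^esub> u) x = (\<Sum>z\<in>carrier \<Gamma>. if z = x \<otimes>\<^bsub>\<Gamma>\<^esub> a then u (x \<otimes>\<^bsub>\<Gamma>\<^esub> a) else 0)"
      unfolding A.mult_eq[OF x] using a(1) ac x
      by (intro sum.cong) (auto simp: v_def tg_elem_def N_iff \<beta>_one)
    then show "(v \<otimes>\<^bsub>A\<^esub> u) x = u (x \<otimes>\<^bsub>\<Gamma>\<^esub> a)" using gr(2) ac x by simp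
  qed
  have comm: "u \<otimes>\<^bsub>A\<^esub> v = v \<otimes>\<^bsub>A\<^esub> u"
  proof
    fix x show "(u \<otimes>\<^bsub>A\<^esub> v) x = (v \<otimes>\<^bsub>A\<^esub> u) x"
      by (cases "x \<in> carrier \<Gamma>") (simp_all add: uv vu A.mult_outside)
  qed
  \<comment> \<open>As \<open>u\<close> and \<open>v\<close> commute, their product inherits
    torsion; its coefficient at 1 is \<open>u a\<close>.\<close>
  have "(u \<otimes>\<^bsub>A\<^esub> v) [^]\<^bsub>A\<^esub> (k * ?n) = (u [^]\<^bsub>A\<^esub> k) [^]\<^bsub>A\<^esub> ?n \<otimes>\<^bsub>A\<^esub> (v [^]\<^bsub>A\<^esub> ?n) [^]\<^bsub>A\<^esub> k"
    using A.A.pow_mult_distrib[OF comm u(1) v] u(1) v by (simp add: A.A.nat_pow_pow mult.commute)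
  then have pow: "(u \<otimes>\<^bsub>A\<^esub> v) [^]\<^bsub>A\<^esub> (k * ?n) = \<one>\<^bsub>A\<^esub>" by (simp add: k(2) vn)
  have u1: "(u \<otimes>\<^bsub>A\<^esub> v) \<one>\<^bsub>\<Gamma>\<^esub> = u a" using uv[of "\<one>\<^bsub>\<Gamma>\<^esub>"] ac by simp
  have "u \<otimes>\<^bsub>A\<^esub> v = tg_elem ((u \<otimes>\<^bsub>A\<^esub> v) \<one>\<^bsub>\<Gamma>\<^esub>) \<one>\<^bsub>\<Gamma>\<^esub>"
    by (rule torsion_scalar[OF A.twisted_axioms _ pow _ _ B\<^sub>R])
      (use u(1) v k(1) order_pos a(2) u1 in auto)
  then have scalar: "u \<otimes>\<^bsub>A\<^esub> v = tg_elem (u a) \<one>\<^bsub>\<Gamma>\<^esub>" by (simp add: u1)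
  have va: "v \<otimes>\<^bsub>A\<^esub> tg_elem 1 a = \<one>\<^bsub>A\<^esub>"
    using ac a(1) by (simp add: v_def A.tg_elem_mult A.one_eq N_iff \<beta>_one)
  have "tg_elem 1 a \<in> carrier A" by (rule tg_elem_closed[OF R one_R ac])
  then have "u = (u \<otimes>\<^bsub>A\<^esub> v) \<otimes>\<^bsub>A\<^esub> tg_elem 1 a" using u(1) v va by (simp add: A.A.m_assoc)
  also have "\<dots> = tg_elem (u a) a"
    unfolding scalar using ac a(1) by (simp add: A.tg_elem_mult N_iff \<beta>_one)
  finally have ua: "u = tg_elem (u a) a" .
  \<comment> \<open>It remains to find the scalar, which \<open>\<Psi> u = 1\<close>
    determines.\<close>
  have "u a \<in> R" using u(1) ac by (simp add: twisted_group_ring_def)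
  then have "\<Psi> (tg_elem (u a) a) = tg_elem (u a * \<chi> a) \<one>\<^bsub>G\<^esub>" by (rule Psi_tg_elem_N[OF a(1)])
  then have "tg_elem (u a * \<chi> a) \<one>\<^bsub>G\<^esub> = tg_elem 1 \<one>\<^bsub>G\<^esub>" using u(2) ua by (simp add: B.one_eq)
  then have "u a * \<chi> a = 1" by (metis tg_elem_def)
  then have "u a = inverse (\<chi> a)" by (metis inverse_unique mult.commute)
  then show "u \<in> {tg_elem (inverse (\<chi> a)) a | a. a \<in> N}" using ua a(1) by auto
qed

end

theorem theorem5:
  fixes \<Gamma> :: "('g, 'c) monoid_scheme" and G :: "('h, 'd) monoid_scheme"
    and N :: "'g set" and lam :: "'g \<Rightarrow> 'h" and \<mu> :: "'h \<Rightarrow> 'g"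
    and F R :: "'k::field_char_0 set"
    and \<beta> :: "'h \<Rightarrow> 'h \<Rightarrow> 'k" and L :: "('g \<Rightarrow> 'k) set" and \<chi> :: "'g \<Rightarrow> 'k"
  defines "A \<equiv> twisted_group_ring \<Gamma> R (\<lambda>x y. \<beta> (lam x) (lam y))"
    and "B \<equiv> twisted_group_ring G (adjoin_values R N \<chi>)
               (\<lambda>g h. \<beta> g h * \<chi> (ext_cocycle \<Gamma> G \<mu> g h))"
    and "\<Psi> \<equiv> Psi \<Gamma> G N \<mu> \<chi>"
  assumes "number_field F" and "order_in R F"
    and "group \<Gamma>" and "finite (carrier \<Gamma>)" and "group G" and "finite (carrier G)"
    and "lam \<in> hom \<Gamma> G" and "lam ` carrier \<Gamma> = carrier G" and "N = kernel \<Gamma> G lam"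
    and "comm_group (\<Gamma>\<lparr>carrier := N\<rparr>)"
    and "\<mu> \<in> carrier G \<rightarrow> carrier \<Gamma>" and "\<forall>g\<in>carrier G. lam (\<mu> g) = g"
    and "\<mu> \<one>\<^bsub>G\<^esub> = \<one>\<^bsub>\<Gamma>\<^esub>"
    and "two_cocycle G R \<beta>"
    and "splitting_field (\<Gamma>\<lparr>carrier := N\<rparr>) TYPE('k)"
    and "is_Lin (\<Gamma>\<lparr>carrier := N\<rparr>) F L" and "\<chi> \<in> L"
    and "\<forall>g\<in>carrier G. \<forall>n\<in>N. \<chi> (\<mu> g \<otimes>\<^bsub>\<Gamma>\<^esub> n \<otimes>\<^bsub>\<Gamma>\<^esub> inv\<^bsub>\<Gamma>\<^esub> (\<mu> g)) = \<chi> n"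
  shows "finite (rcosets\<^bsub>units_of B\<^esub> (\<Psi> ` Units A)) \<and>
    ((\<forall>n\<in>N. \<forall>x\<in>carrier \<Gamma>. n \<otimes>\<^bsub>\<Gamma>\<^esub> x = x \<otimes>\<^bsub>\<Gamma>\<^esub> n) \<and> \<chi> ` N \<subseteq> unit_set R \<longrightarrow>
       torsion_units A \<inter> kernel (units_of A) (units_of B) \<Psi> = {tg_elem (inverse (\<chi> a)) a | a. a \<in> N})"
proof -
  obtain B\<^sub>R where B\<^sub>R: "finite B\<^sub>R" "R = int_module.span B\<^sub>R"
    using \<open>order_in R F\<close> by (auto simp: order_in_def)
  have "\<chi> \<in> hom (\<Gamma>\<lparr>carrier := N\<rparr>) (units_of \<K>)"
    using \<open>is_Lin (\<Gamma>\<lparr>carrier := N\<rparr>) F L\<close> \<open>\<chi> \<in> L\<close> by (auto simp: is_Lin_def linear_characters_def)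
  then interpret order_setting \<Gamma> G N lam \<mu> R \<beta> \<chi> F B\<^sub>R
    using assms B\<^sub>R
    by (intro order_setting.intro psi_setting.intro order_setting_axioms.intro)
      (simp_all only: order_in_def number_field_def)
  show ?thesis
    unfolding A_def B_def \<Psi>_def using finite_cokernel torsion_kernel by blast
qed

end
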